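(* Fix an integer $d\ge 3$ and let $G_n$ be a uniformly random $d$-regular graph on $n$ vertices ($n$ ranging over integers with $nd$ even). Then there is a constant $K=K(d)$, depending only on $d$, such that with probability tending to $1$ as $n\to\infty$, $$M_n:=\max_{v\in G_n} T_n(v)\;\le\; K\, n\,\log_{d-1}^3(n).$$ In other words, the maximum vertex congestion under geodesic routing is $O(n\log_{d-1}^3 n)$ asymptotically almost surely.
   Context: Traffic flow under geodesic routing: for each unordered pair $\{a,b\}$ of distinct vertices of a graph $G$ (edges of length $1$), one unit of flow is sent from $a$ to $b$ along shortest paths; if there are several shortest paths between $a$ and $b$, the unit of flow is split equally among all of them. For a vertex $v$, $T_n(v)$ denotes the total flow passing through $v$ in $G_n$, i.e. $T_n(v)=\sum_{\{a,b\}} \frac{\#\{\text{shortest } a\text{–}b \text{ paths containing } v\}}{\#\{\text{shortest } a\text{–}b\text{ paths}\}}$, summed over all unordered pairs of distinct vertices. A random $d$-regular graph means a graph chosen uniformly at random among all $d$-regular simple graphs on the vertex set $\{1,\dots,n\}$. "Asymptotically almost surely" means with probability tending to $1$ as $n\to\infty$. *)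

theory Defs
  imports "HOL-Probability.Probability"
begin

text \<open>A simple graph on the vertex set {1..n} is represented by its edge set,
  a set of 2-element subsets of {1..n}.\<close>

definition all_edges :: "nat \<Rightarrow> nat set set" where
  "all_edges n = {e. \<exists>a b. e = {a, b} \<and> a \<noteq> b \<and> a \<in> {1..n} \<and> b \<in> {1..n}}"

definition degree :: "nat set set \<Rightarrow> nat \<Rightarrow> nat" where
  "degree E v = card {e \<in> E. v \<in> e}"

definition regular_graphs :: "nat \<Rightarrow> nat \<Rightarrow> nat set set set" where
  "regular_graphs n d = {E. E \<subseteq> all_edges n \<and> (\<forall>v\<in>{1..n}. degree E v = d)}"

definition is_walk :: "nat set set \<Rightarrow> nat list \<Rightarrow> bool" where
  "is_walk E p \<longleftrightarrow> p \<noteq> [] \<and> (\<forall>i. Suc i < length p \<longrightarrow> {p ! i, p ! Suc i} \<in> E)"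

definition walks :: "nat set set \<Rightarrow> nat \<Rightarrow> nat \<Rightarrow> nat list set" where
  "walks E a b = {p. is_walk E p \<and> hd p = a \<and> last p = b}"

definition geodesics :: "nat set set \<Rightarrow> nat \<Rightarrow> nat \<Rightarrow> nat list set" where
  "geodesics E a b = {p \<in> walks E a b. \<forall>q \<in> walks E a b. length p \<le> length q}"

text \<open>Total geodesic flow through v: sum over unordered pairs {a,b} (a<b) of distinct
  vertices of the fraction of shortest a-b paths containing v.
  (Pairs with no path contribute 0.)\<close>
definition traffic :: "nat \<Rightarrow> nat set set \<Rightarrow> nat \<Rightarrow> real" where
  "traffic n E v = (\<Sum>(a, b) \<in> {(a, b). a \<in> {1..n} \<and> b \<in> {1..n} \<and> a < b}.
      real (card {p \<in> geodesics E a b. v \<in> set p}) / real (card (geodesics E a b)))"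

definition max_traffic :: "nat \<Rightarrow> nat set set \<Rightarrow> real" where
  "max_traffic n E = Max (traffic n E ` {1..n})"

end

theory Submission
  imports Defs "HOL-Real_Asymp.Real_Asymp"
begin

text \<open>
  Write \<open>q = d - 1\<close>. If all distances are at most \<open>D\<close>, then a pair \<open>{a, b}\<close> that sends flow through \<open>v\<close>
  satisfies \<open>dist a v + dist v b \<le> D\<close>, so there are \<open>O(D * q ^ D)\<close> such pairs; it therefore suffices
  to show \<open>q ^ D = O(n * (ln n)\<^sup>2)\<close>. All probabilities are estimated by switchings inside the set of
  simple regular graphs, without the configuration model. A prescribed set of \<open>m\<close> edges is present with
  probability at most \<open>(d\<^sup>2 / n) ^ m\<close>, hence by a union bound every vertex set \<open>S\<close> of size at most
  \<open>n powr (2/3)\<close> spans at most \<open>(1 + C / ln n) * |S|\<close> edges. This forces balls of radius \<open>r\<close> to have at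
  least \<open>const * q ^ r\<close> vertices, in particular about \<open>sqrt n * ln n\<close> of them for a suitable \<open>r\<close>. Finally,
  if two disjoint such balls with many outgoing edges were not joined by an edge, one could switch pairs
  of outgoing edges into crossing edges one after the other; each step multiplies the number of graphs by
  at least \<open>const * ln n\<close>, so after \<open>3 * ln n\<close> steps the initial set is seen to have density at most
  \<open>n ^ (-3)\<close>. Thus \<open>D = 2 * r + 1\<close> for all pairs with high probability.
\<close>

section \<open>Neighbourhoods in regular graphs\<close>

definition nbrs :: "nat set set \<Rightarrow> nat \<Rightarrow> nat set" where
  "nbrs E u = {x. {u, x} \<in> E}"

text \<open>Edges are taken with an orientation because a switching depends on which end of the
  second edge is joined to which end of the first.\<close>

definition arcs :: "nat set set \<Rightarrow> (nat \<times> nat) set" where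
  "arcs E = {(x, y). {x, y} \<in> E}"

lemma mem_nbrs: "x \<in> nbrs E u \<longleftrightarrow> {u, x} \<in> E"
  by (simp add: nbrs_def)

lemma nbrs_sym: "x \<in> nbrs E u \<longleftrightarrow> u \<in> nbrs E x"
  by (simp add: nbrs_def insert_commute)

lemma in_all_edges: "{a, b} \<in> all_edges n \<longleftrightarrow> a \<noteq> b \<and> a \<in> {1..n} \<and> b \<in> {1..n}"
  unfolding all_edges_def by (auto simp: doubleton_eq_iff)

lemma all_edges_subset_Pow: "all_edges n \<subseteq> Pow {1..n}"
  unfolding all_edges_def by auto

lemma finite_all_edges: "finite (all_edges n)"
  by (rule finite_subset[OF all_edges_subset_Pow]) simp

lemma finite_regular_graphs: "finite (regular_graphs n d)"
  by (rule finite_subset[of _ "Pow (all_edges n)"])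
     (auto simp: regular_graphs_def finite_all_edges)

lemma degree_eq_card_nbrs:
  assumes "E \<subseteq> all_edges n"
  shows "degree E v = card (nbrs E v)"
proof -
  have "bij_betw (\<lambda>x. {v, x}) (nbrs E v) {e \<in> E. v \<in> e}"
    unfolding bij_betw_def
  proof
    show "inj_on (\<lambda>x. {v, x}) (nbrs E v)"
      by (auto simp: inj_on_def doubleton_eq_iff)
    show "(\<lambda>x. {v, x}) ` nbrs E v = {e \<in> E. v \<in> e}"
    proof
      show "{e \<in> E. v \<in> e} \<subseteq> (\<lambda>x. {v, x}) ` nbrs E v"
      proof
        fix e assume e: "e \<in> {e \<in> E. v \<in> e}"
        then obtain a b where "e = {a, b}" using assms unfolding all_edges_def by blast
        with e have "\<exists>x. e = {v, x}" by auto
        with e show "e \<in> (\<lambda>x. {v, x}) ` nbrs E v" by (auto simp: mem_nbrs)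
      qed
    qed (auto simp: mem_nbrs)
  qed
  then show ?thesis unfolding degree_def by (simp add: bij_betw_same_card)
qed

lemma regular_graphs_alt:
  "E \<in> regular_graphs n d \<longleftrightarrow> E \<subseteq> all_edges n \<and> (\<forall>v\<in>{1..n}. card (nbrs E v) = d)"
  unfolding regular_graphs_def by (auto simp: degree_eq_card_nbrs)

context
  fixes n d :: nat and E :: "nat set set"
  assumes E: "E \<in> regular_graphs n d"
begin

lemma edge_regular: "{a, b} \<in> E \<Longrightarrow> a \<noteq> b \<and> a \<in> {1..n} \<and> b \<in> {1..n}"
  using E in_all_edges unfolding regular_graphs_def by blast

lemma nbrs_subset_regular: "nbrs E v \<subseteq> {1..n}"
  using edge_regular by (auto simp: mem_nbrs)

lemma finite_nbrs_regular: "finite (nbrs E v)"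
  using nbrs_subset_regular by (rule finite_subset) simp

lemma card_nbrs_regular: "v \<in> {1..n} \<Longrightarrow> card (nbrs E v) = d"
  using E by (simp add: regular_graphs_alt)

lemma card_nbrs_regular_le: "card (nbrs E v) \<le> d"
proof (cases "v \<in> {1..n}")
  case False
  then have "nbrs E v = {}" using edge_regular by (auto simp: mem_nbrs)
  then show ?thesis by simp
qed (simp add: card_nbrs_regular)

lemma arcs_regular: "arcs E = Sigma {1..n} (nbrs E)"
  using edge_regular by (auto simp: arcs_def mem_nbrs)

lemma finite_arcs_regular: "finite (arcs E)"
  unfolding arcs_regular using finite_nbrs_regular by auto

lemma card_arcs_regular: "card (arcs E) = n * d"
  unfolding arcs_regular using finite_nbrs_regular
  by (subst card_SigmaI) (auto simp: card_nbrs_regular simp del: atLeastAtMost_iff)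

lemma finite_regular: "finite E"
  using E finite_all_edges by (auto simp: regular_graphs_def intro: finite_subset)

lemma card_Sigma_nbrs_le:
  assumes "finite X" "card X \<le> k"
  shows "card (Sigma X (nbrs E)) \<le> k * d"
proof -
  have "card (Sigma X (nbrs E)) = (\<Sum>x\<in>X. card (nbrs E x))"
    using assms finite_nbrs_regular by (subst card_SigmaI) auto
  also have "\<dots> \<le> (\<Sum>x\<in>X. d)" by (intro sum_mono card_nbrs_regular_le)
  also have "\<dots> \<le> k * d" using assms by simp
  finally show ?thesis .
qed

end

section \<open>Switchings\<close>

definition switch :: "nat \<Rightarrow> nat \<Rightarrow> nat \<Rightarrow> nat \<Rightarrow> nat set set \<Rightarrow> nat set set" where
  "switch p q r s E = (E - {{p, q}, {r, s}}) \<union> {{p, r}, {q, s}}"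

text \<open>The remaining distinctness conditions follow: for instance \<open>p = s\<close> would make
  \<open>{p, r}\<close> equal to the edge \<open>{r, s}\<close>.\<close>
definition switchable :: "nat \<Rightarrow> nat \<Rightarrow> nat \<Rightarrow> nat \<Rightarrow> nat set set \<Rightarrow> bool" where
  "switchable p q r s E \<longleftrightarrow>
     {p, q} \<in> E \<and> {r, s} \<in> E \<and> {p, r} \<notin> E \<and> {q, s} \<notin> E \<and> p \<noteq> r \<and> q \<noteq> s"

text \<open>The arguments are ordered so that exchanging the middle two inverts the switching. This
  recovers \<open>E\<close> because the deleted edges belong to \<open>E\<close> and the inserted
  ones do not.\<close>

lemma switch_switch:
  assumes "switchable p q r s E"
  shows "switch p r q s (switch p q r s E) = E"
proof -
  have *: "((E - P) \<union> Q) - Q \<union> P = E" if "Q \<inter> E = {}" "P \<subseteq> E" for P Q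
    using that by blast
  show ?thesis unfolding switch_def
    by (rule *) (use assms in \<open>auto simp: switchable_def\<close>)
qed

lemma switchable_distinct:
  assumes "E \<in> regular_graphs n d" "switchable p q r s E"
  shows "distinct [p, q, r, s]"
proof -
  have "p \<noteq> q" "r \<noteq> s"
    using assms edge_regular[OF assms(1)] unfolding switchable_def by blast+
  moreover have "p \<noteq> s" "q \<noteq> r"
    using assms(2) unfolding switchable_def by (auto simp: insert_commute)
  ultimately show ?thesis using assms(2) unfolding switchable_def by auto
qed

lemma mem_switch:
  "{v, x} \<in> switch p q r s E \<longleftrightarrow>
      {v, x} \<in> E \<and> \<not> (v = p \<and> x = q \<or> v = q \<and> x = p \<or> v = r \<and> x = s \<or> v = s \<and> x = r)
      \<or> v = p \<and> x = r \<or> v = r \<and> x = p \<or> v = q \<and> x = s \<or> v = s \<and> x = q"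
  by (simp only: switch_def Un_iff Diff_iff insert_iff empty_iff doubleton_eq_iff simp_thms disj_assoc)

lemma switch_commute: "switch p q r s E = switch r s p q E"
  by (simp add: switch_def insert_commute)

lemma nbrs_switch:
  assumes "distinct [p, q, r, s]"
  shows "nbrs (switch p q r s E) v =
    (if v = p then insert r (nbrs E p - {q})
     else if v = q then insert s (nbrs E q - {p})
     else if v = r then insert p (nbrs E r - {s})
     else if v = s then insert q (nbrs E s - {r})
     else nbrs E v)" (is "_ = ?R")
proof (rule set_eqI)
  fix x
  have d: "p \<noteq> q" "p \<noteq> r" "p \<noteq> s" "q \<noteq> r" "q \<noteq> s" "r \<noteq> s"
      "q \<noteq> p" "r \<noteq> p" "s \<noteq> p" "r \<noteq> q" "s \<noteq> q" "s \<noteq> r"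
    using assms by auto
  show "x \<in> nbrs (switch p q r s E) v \<longleftrightarrow> x \<in> ?R"
    unfolding mem_nbrs mem_switch using d
    by (cases "v \<in> {p, q, r, s}"; cases "x \<in> {p, q, r, s}") (auto simp: mem_nbrs)
qed

lemma switch_regular:
  assumes E: "E \<in> regular_graphs n d" and sw: "switchable p q r s E"
  shows "switch p q r s E \<in> regular_graphs n d"
proof -
  note dist = switchable_distinct[OF assms]
  have edge: "\<And>a b. {a, b} \<in> E \<Longrightarrow> a \<noteq> b \<and> a \<in> {1..n} \<and> b \<in> {1..n}"
    using edge_regular[OF E] by blast
  have sub: "switch p q r s E \<subseteq> all_edges n"
    using E sw edge[of p q] edge[of r s] dist in_all_edges[of p r n] in_all_edges[of q s n]
    unfolding switch_def switchable_def regular_graphs_def by auto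
  \<comment> \<open>At each of the four vertices one neighbour is traded for a non-neighbour, which
    keeps the degree.\<close>
  have exch: "card (insert x (nbrs E v - {y})) = card (nbrs E v)"
    if "{v, x} \<notin> E" "{v, y} \<in> E" for x y v
  proof -
    have "card (insert x (nbrs E v - {y})) = Suc (card (nbrs E v - {y}))"
      using that(1) finite_nbrs_regular[OF E, of v] by (simp add: mem_nbrs)
    also have "\<dots> = card (nbrs E v)"
      using that(2) finite_nbrs_regular[OF E, of v] by (intro card_Suc_Diff1) (auto simp: mem_nbrs)
    finally show ?thesis .
  qed
  have sw': "{p, q} \<in> E" "{q, p} \<in> E" "{r, s} \<in> E" "{s, r} \<in> E"
      "{p, r} \<notin> E" "{r, p} \<notin> E" "{q, s} \<notin> E" "{s, q} \<notin> E"
    using sw by (simp_all add: switchable_def insert_commute)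
  have "card (nbrs (switch p q r s E) v) = d" if v: "v \<in> {1..n}" for v
  proof -
    have "card (nbrs (switch p q r s E) v) = card (nbrs E v)"
      unfolding nbrs_switch[OF dist] by (simp add: exch sw')
    then show ?thesis using card_nbrs_regular[OF E v] by simp
  qed
  with sub show ?thesis by (simp add: regular_graphs_alt)
qed

text \<open>Double counting of pairs of a graph and a switching \<open>t\<close>. The map
  \<open>(G, t) \<mapsto> (f t G, t)\<close> is injective because \<open>t\<close> carries all the
  data by which \<open>g\<close> undoes \<open>f\<close>; \<open>lo\<close> bounds the forward
  choices and \<open>hi\<close> the reverse ones.\<close>

lemma switching_count:
  fixes f g :: "'t \<Rightarrow> 'g \<Rightarrow> 'g"
  assumes fin: "finite \<A>" "finite \<B>"
    and X: "\<And>G. G \<in> \<A> \<Longrightarrow> finite (X G) \<and> lo \<le> card (X G)"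
    and Y: "\<And>G. G \<in> \<B> \<Longrightarrow> finite (Y G) \<and> card (Y G) \<le> hi"
    and f: "\<And>G t. G \<in> \<A> \<Longrightarrow> t \<in> X G \<Longrightarrow> f t G \<in> \<B> \<and> t \<in> Y (f t G) \<and> g t (f t G) = G"
  shows "card \<A> * lo \<le> card \<B> * hi"
proof -
  have "card \<A> * lo = (\<Sum>G\<in>\<A>. lo)" by simp
  also have "\<dots> \<le> (\<Sum>G\<in>\<A>. card (X G))" using X by (intro sum_mono) auto
  also have "\<dots> = card (Sigma \<A> X)" using fin X by (subst card_SigmaI) auto
  also have "\<dots> \<le> card (Sigma \<B> Y)"
  proof (rule card_inj_on_le[of "\<lambda>(G, t). (f t G, t)"])
    show "inj_on (\<lambda>(G, t). (f t G, t)) (Sigma \<A> X)"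
    proof (rule inj_onI)
      fix x y assume xy: "x \<in> Sigma \<A> X" "y \<in> Sigma \<A> X"
        and eq: "(case x of (G, t) \<Rightarrow> (f t G, t)) = (case y of (G, t) \<Rightarrow> (f t G, t))"
      obtain G t G' t' where [simp]: "x = (G, t)" "y = (G', t')" by (cases x, cases y)
      from eq have t: "t = t'" and "f t G = f t G'" by auto
      moreover have "g t (f t G) = G" "g t' (f t' G') = G'"
        using xy f by auto
      ultimately have "G = G'" using t by metis
      with t show "x = y" by simp
    qed
    show "(\<lambda>(G, t). (f t G, t)) ` Sigma \<A> X \<subseteq> Sigma \<B> Y" using f by auto
    show "finite (Sigma \<B> Y)" using fin Y by auto
  qed
  also have "\<dots> = (\<Sum>G\<in>\<B>. card (Y G))" using fin Y by (subst card_SigmaI) auto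
  also have "\<dots> \<le> (\<Sum>G\<in>\<B>. hi)" using Y by (intro sum_mono) auto
  also have "\<dots> = card \<B> * hi" by simp
  finally show ?thesis .
qed

section \<open>Prescribed edges\<close>

definition regular_containing :: "nat \<Rightarrow> nat \<Rightarrow> nat set set \<Rightarrow> nat set set set" where
  "regular_containing n d F = {E \<in> regular_graphs n d. F \<subseteq> E}"

lemma finite_regular_containing: "finite (regular_containing n d F)"
  unfolding regular_containing_def using finite_regular_graphs by auto

lemma finite_arcs_card_le:
  assumes "finite F" "F \<subseteq> all_edges n"
  shows "finite (arcs F) \<and> card (arcs F) \<le> 2 * card F"
proof -
  define A :: "nat set \<Rightarrow> (nat \<times> nat) set" where "A e = {(x, y). {x, y} = e}" for e
  have eq: "arcs F = (\<Union>e\<in>F. A e)" by (auto simp: arcs_def A_def)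
  have each: "finite (A e) \<and> card (A e) \<le> 2" if "e \<in> F" for e
  proof -
    obtain a b where "e = {a, b}" using assms \<open>e \<in> F\<close> unfolding all_edges_def by blast
    then have sub: "A e \<subseteq> {(a, b), (b, a)}" by (auto simp: A_def doubleton_eq_iff)
    have "card {(a, b), (b, a)} \<le> Suc (card {(b, a)})" by (rule card_insert_le_m1) auto
    moreover have "card (A e) \<le> card {(a, b), (b, a)}" by (rule card_mono[OF _ sub]) simp
    ultimately show ?thesis using finite_subset[OF sub] by simp
  qed
  have "card (arcs F) \<le> (\<Sum>e\<in>F. card (A e))"
    unfolding eq by (rule card_UN_le[OF assms(1)])
  also have "\<dots> \<le> (\<Sum>e\<in>F. 2)" using each by (intro sum_mono) blast
  finally have "card (arcs F) \<le> 2 * card F" by simp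
  moreover have "finite (arcs F)" unfolding eq using each assms(1) by blast
  ultimately show ?thesis by blast
qed

text \<open>The edge \<open>{u, w}\<close> is switched away against an arc \<open>(x, y)\<close>
  outside \<open>F\<close>. Of the at least \<open>3 * n\<close> arcs, at most \<open>n / 2\<close>
  come from \<open>F\<close> and at most \<open>n\<close> are blocked near \<open>u\<close> or
  \<open>w\<close>, so \<open>n\<close> choices remain. In reverse, \<open>x\<close> is a neighbour
  of \<open>u\<close> and \<open>y\<close> one of \<open>w\<close>, which leaves at most
  \<open>d * d\<close> choices.\<close>

lemma card_regular_containing_insert:
  assumes n: "2 * d + 2 * d * d \<le> n" and F: "finite F" "4 * card F \<le> n" "{u, w} \<notin> F"
    and d: "d \<ge> 3"
  shows "card (regular_containing n d (insert {u, w} F)) * n \<le> card (regular_containing n d F) * (d * d)"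
proof (rule switching_count[where f = "\<lambda>(x, y). switch u w x y" and g = "\<lambda>(x, y). switch u x w y" and
      X = "\<lambda>G. {(x, y). {x, y} \<in> G \<and> {x, y} \<notin> F \<and> switchable u w x y G}" and
      Y = "\<lambda>G. nbrs G u \<times> nbrs G w"])
  show "finite (regular_containing n d (insert {u, w} F))" "finite (regular_containing n d F)"
    by (rule finite_regular_containing)+
next
  fix G assume "G \<in> regular_containing n d (insert {u, w} F)"
  then have G: "G \<in> regular_graphs n d" "F \<subseteq> G" and uw: "{u, w} \<in> G"
    by (auto simp: regular_containing_def)
  note fin = finite_nbrs_regular[OF G(1)]
  define X where "X = {(x, y). {x, y} \<in> G \<and> {x, y} \<notin> F \<and> switchable u w x y G}"
  have FE: "F \<subseteq> all_edges n" using G by (auto simp: regular_graphs_def)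
  have fX: "finite X"
    by (rule finite_subset[OF _ finite_arcs_regular[OF G(1)]]) (auto simp: X_def arcs_def)
  \<comment> \<open>The blocked arcs are those with \<open>x = u\<close>, with \<open>y = w\<close>,
    with \<open>x\<close> adjacent to \<open>u\<close>, and with \<open>y\<close> adjacent to
    \<open>w\<close>.\<close>
  define B1 where "B1 = Sigma {u} (nbrs G)"
  define B2 where "B2 = prod.swap ` Sigma {w} (nbrs G)"
  define B3 where "B3 = Sigma (nbrs G u) (nbrs G)"
  define B4 where "B4 = prod.swap ` Sigma (nbrs G w) (nbrs G)"
  have "arcs G \<subseteq> X \<union> arcs F \<union> B1 \<union> B2 \<union> B3 \<union> B4"
  proof
    fix z assume "z \<in> arcs G"
    then obtain x y where z: "z = (x, y)" "{x, y} \<in> G" by (auto simp: arcs_def)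
    show "z \<in> X \<union> arcs F \<union> B1 \<union> B2 \<union> B3 \<union> B4"
    proof (cases "{x, y} \<in> F \<or> x = u \<or> y = w \<or> {u, x} \<in> G \<or> {w, y} \<in> G")
      case True
      have sym: "{y, x} \<in> G" using z by (simp add: insert_commute)
      from True z sym show ?thesis
        by (auto simp: arcs_def B1_def B2_def B3_def B4_def mem_nbrs image_iff)
    next
      case False
      with z uw show ?thesis by (auto simp: X_def switchable_def)
    qed
  qed
  moreover have "finite (X \<union> arcs F \<union> B1 \<union> B2 \<union> B3 \<union> B4)"
    using fX finite_arcs_card_le[OF F(1) FE] fin by (auto simp: B1_def B2_def B3_def B4_def)
  ultimately have "card (arcs G) \<le> card (X \<union> arcs F \<union> B1 \<union> B2 \<union> B3 \<union> B4)"
    by (rule card_mono[rotated])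
  also have "\<dots> \<le> card X + card (arcs F) + card B1 + card B2 + card B3 + card B4"
    by (intro order.trans[OF card_Un_le] add_mono order.refl)
  also have "card (arcs F) \<le> 2 * card F" using finite_arcs_card_le[OF F(1) FE] by simp
  also have "card B1 \<le> 1 * d" unfolding B1_def by (rule card_Sigma_nbrs_le[OF G(1)]) auto
  also have "card B2 \<le> card (Sigma {w} (nbrs G))" unfolding B2_def
    by (rule card_image_le) (use fin in auto)
  also have "card (Sigma {w} (nbrs G)) \<le> 1 * d" by (rule card_Sigma_nbrs_le[OF G(1)]) auto
  also have "card B3 \<le> d * d" unfolding B3_def
    by (rule card_Sigma_nbrs_le[OF G(1)]) (use fin card_nbrs_regular_le[OF G(1)] in auto)
  also have "card B4 \<le> card (Sigma (nbrs G w) (nbrs G))" unfolding B4_def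
    by (rule card_image_le) (use fin in auto)
  also have "card (Sigma (nbrs G w) (nbrs G)) \<le> d * d"
    by (rule card_Sigma_nbrs_le[OF G(1)]) (use fin card_nbrs_regular_le[OF G(1)] in auto)
  finally have "n * d \<le> card X + 2 * card F + 2 * d + 2 * d * d"
    using card_arcs_regular[OF G(1)] by simp
  moreover have "n * 3 \<le> n * d" using d by simp
  ultimately have "n \<le> card X" using n F(2) by linarith
  with fX show "finite {(x, y). {x, y} \<in> G \<and> {x, y} \<notin> F \<and> switchable u w x y G} \<and>
     n \<le> card {(x, y). {x, y} \<in> G \<and> {x, y} \<notin> F \<and> switchable u w x y G}"
    unfolding X_def by simp
next
  fix G assume "G \<in> regular_containing n d F"
  then have G: "G \<in> regular_graphs n d" by (auto simp: regular_containing_def)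
  show "finite (nbrs G u \<times> nbrs G w) \<and> card (nbrs G u \<times> nbrs G w) \<le> d * d"
    using finite_nbrs_regular[OF G] card_nbrs_regular_le[OF G]
    by (auto simp: card_cartesian_product intro!: mult_le_mono)
next
  fix G t
  assume G: "G \<in> regular_containing n d (insert {u, w} F)"
    and t: "t \<in> {(x, y). {x, y} \<in> G \<and> {x, y} \<notin> F \<and> switchable u w x y G}"
  obtain x y where [simp]: "t = (x, y)" by (cases t)
  have xy: "{x, y} \<notin> F" "switchable u w x y G" using t by auto
  have "switch u w x y G \<in> regular_graphs n d"
    using switch_regular[OF _ xy(2)] G by (auto simp: regular_containing_def)
  moreover have "F \<subseteq> switch u w x y G"
    using G F(3) xy(1) unfolding regular_containing_def switch_def by auto
  moreover have "switch u x w y (switch u w x y G) = G" by (rule switch_switch[OF xy(2)])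
  moreover have "x \<in> nbrs (switch u w x y G) u" "y \<in> nbrs (switch u w x y G) w"
    by (auto simp: mem_nbrs switch_def)
  ultimately show "(case t of (x, y) \<Rightarrow> switch u w x y) G \<in> regular_containing n d F \<and>
       t \<in> nbrs ((case t of (x, y) \<Rightarrow> switch u w x y) G) u \<times> nbrs ((case t of (x, y) \<Rightarrow> switch u w x y) G) w \<and>
       (case t of (x, y) \<Rightarrow> switch u x w y) ((case t of (x, y) \<Rightarrow> switch u w x y) G) = G"
    by (simp add: regular_containing_def)
qed

text \<open>The prescribed edges are released one at a time, each contributing a factor
  \<open>d * d / n\<close>.\<close>

lemma card_regular_containing_le:
  assumes n: "2 * d + 2 * d * d \<le> n" and d: "d \<ge> 3" and F: "finite F" "4 * card F \<le> n"
  shows "real (card (regular_containing n d F))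
    \<le> (real (d * d) / real n) ^ card F * real (card (regular_graphs n d))"
  using F
proof (induction F rule: finite_induct)
  case empty
  then show ?case by (simp add: regular_containing_def)
next
  case (insert e F)
  show ?case
  proof (cases "e \<in> all_edges n")
    case False
    then have "regular_containing n d (insert e F) = {}"
      by (auto simp: regular_containing_def regular_graphs_def)
    then show ?thesis by simp
  next
    case True
    then obtain u w where e: "e = {u, w}" unfolding all_edges_def by blast
    have n0: "real n > 0" using n d by (cases n) auto
    have c: "4 * card F \<le> n" using insert by simp
    have "card (regular_containing n d (insert e F)) * n \<le> card (regular_containing n d F) * (d * d)"
      unfolding e using insert c e by (intro card_regular_containing_insert n d) auto
    then have "real (card (regular_containing n d (insert e F))) * real n
      \<le> real (card (regular_containing n d F)) * real (d * d)"
      by (metis of_nat_le_iff of_nat_mult)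
    then have "real (card (regular_containing n d (insert e F)))
      \<le> real (d * d) / real n * real (card (regular_containing n d F))"
      using n0 by (simp add: field_simps)
    also have "\<dots> \<le> real (d * d) / real n *
        ((real (d * d) / real n) ^ card F * real (card (regular_graphs n d)))"
      by (intro mult_left_mono insert.IH c) auto
    finally show ?thesis using insert by simp
  qed
qed

section \<open>Existence of regular graphs\<close>

text \<open>This is the circulant graph with connection set \<open>D\<close>. Only the positive
  difference of two vertices is tested; closure of \<open>D\<close> under
  \<open>s \<mapsto> n - s\<close> makes this agree with the difference modulo
  \<open>n\<close>.\<close>

lemma circulant_regular:
  assumes D: "D \<subseteq> {0<..<n}" and sym: "\<And>s. s \<in> D \<Longrightarrow> n - s \<in> D"
  shows "{{x, y} | x y. x \<in> {1..n} \<and> y \<in> {1..n} \<and> x < y \<and> y - x \<in> D} \<in> regular_graphs n (card D)"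
    (is "?E \<in> _")
proof -
  have mem: "{a, b} \<in> ?E \<longleftrightarrow> a \<in> {1..n} \<and> b \<in> {1..n} \<and> (a < b \<and> b - a \<in> D \<or> b < a \<and> a - b \<in> D)"
    (is "_ \<longleftrightarrow> ?R") for a b
  proof
    show "{a, b} \<in> ?E \<Longrightarrow> ?R" by (auto simp: doubleton_eq_iff)
    assume R: ?R
    show "{a, b} \<in> ?E"
    proof (cases "a < b")
      case True
      with R have "a \<in> {1..n}" "b \<in> {1..n}" "b - a \<in> D" by auto
      with True show ?thesis by blast
    next
      case False
      with R have "a \<in> {1..n}" "b \<in> {1..n}" "b < a" "a - b \<in> D" by auto
      then have "{b, a} \<in> ?E" by blast
      then show ?thesis by (simp only: insert_commute)
    qed
  qed
  have sub: "?E \<subseteq> all_edges n" by (auto simp: in_all_edges)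
  have "card (nbrs ?E v) = card D" if v: "v \<in> {1..n}" for v
  proof -
    have nb: "nbrs ?E v = {y \<in> {1..n}. v < y \<and> y - v \<in> D \<or> y < v \<and> v - y \<in> D}"
      unfolding nbrs_def mem using v by auto
    \<comment> \<open>\<open>h s\<close> is \<open>v + s\<close> reduced modulo \<open>n\<close>
      into \<open>{1..n}\<close>.\<close>
    define h where "h s = (if v + s \<le> n then v + s else v + s - n)" for s
    have "bij_betw h D (nbrs ?E v)"
      unfolding bij_betw_def
    proof
      show "inj_on h D"
      proof (rule inj_onI)
        fix s t assume "s \<in> D" "t \<in> D" "h s = h t"
        moreover from this have "0 < s" "s < n" "0 < t" "t < n" using D by auto
        ultimately show "s = t" using v by (auto simp: h_def split: if_splits)
      qed
      show "h ` D = nbrs ?E v"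
      proof (rule subset_antisym)
        show "h ` D \<subseteq> nbrs ?E v"
        proof
          fix y assume "y \<in> h ` D"
          then obtain s where s: "s \<in> D" "y = h s" by blast
          then have sn: "0 < s" "s < n" using D by auto
          show "y \<in> nbrs ?E v"
          proof (cases "v + s \<le> n")
            case True
            then show ?thesis unfolding nb using s sn v by (auto simp: h_def)
          next
            case False
            then have "v - y = n - s" "y < v" "1 \<le> y" using s sn v by (auto simp: h_def)
            then show ?thesis unfolding nb using sym[OF s(1)] v by auto
          qed
        qed
        show "nbrs ?E v \<subseteq> h ` D"
        proof
          fix y assume y: "y \<in> nbrs ?E v"
          then consider "v < y" "y - v \<in> D" "y \<le> n" | "y < v" "v - y \<in> D" "1 \<le> y"
            unfolding nb by auto
          then show "y \<in> h ` D"
          proof cases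
            case 1
            then have "y = h (y - v)" by (simp add: h_def)
            with 1 show ?thesis by blast
          next
            case 2
            then have "y = h (n - (v - y))" using v by (auto simp: h_def)
            with sym[OF 2(2)] show ?thesis by blast
          qed
        qed
      qed
    qed
    then show ?thesis by (simp add: bij_betw_same_card)
  qed
  with sub show ?thesis by (simp add: regular_graphs_alt)
qed

text \<open>\<open>pmf_of_set\<close> is the uniform distribution only on a nonempty finite
  set.\<close>

lemma regular_graphs_nonempty:
  assumes "d < n" "even (n * d)"
  shows "regular_graphs n d \<noteq> {}"
proof -
  define k where "k = d div 2"
  \<comment> \<open>Each vertex is joined to the \<open>k\<close> nearest vertices on either side of
    a cycle and, for odd \<open>d\<close>, also to the opposite vertex, which exists because
    \<open>n\<close> is then even.\<close>
  define D where "D = {1..k} \<union> {n - k..<n} \<union> (if odd d then {n div 2} else {})"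
  have k: "2 * k < n" using assms by (simp add: k_def)
  have par: "2 * (n div 2) = n" "d = 2 * k + 1" if "odd d"
    using that assms by (auto simp: k_def)
  have "D \<subseteq> {0<..<n}" using k par assms by (auto simp: D_def split: if_splits)
  moreover have "n - s \<in> D" if "s \<in> D" for s
    using that k par by (auto simp: D_def split: if_splits)
  moreover have "card D = d"
  proof -
    have "card ({1..k} \<union> {n - k..<n}) = 2 * k"
      using k by (subst card_Un_disjoint) auto
    moreover have "n div 2 \<notin> {1..k} \<union> {n - k..<n}" if "odd d"
      using par[OF that] assms by auto
    ultimately show ?thesis
      using par(2) by (cases "odd d") (auto simp: D_def k_def)
  qed
  ultimately show ?thesis using circulant_regular by blast
qed

section \<open>Local sparsity\<close>

definition induced :: "nat set set \<Rightarrow> nat set \<Rightarrow> nat set set" where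
  "induced E S = {e \<in> E. e \<subseteq> S}"

text \<open>\<open>k ^ k / fact k\<close> is a single term of the series of \<open>exp k\<close>, so
  \<open>fact k\<close> is at least \<open>(k / exp 1) ^ k\<close>; this is inserted into
  \<open>n ^ k / fact k\<close>.\<close>

lemma choose_le_exp:
  assumes "k > 0"
  shows "real (n choose k) \<le> (exp 1 * real n / real k) ^ k"
proof -
  have "real k ^ k / fact k \<le> (\<Sum>i<Suc k. real k ^ i / fact i)"
    by (rule member_le_sum) auto
  also have "\<dots> \<le> exp (real k)"
  proof -
    have s: "(\<lambda>i. real k ^ i / fact i) sums exp (real k)"
      using exp_converges[of "real k"] by (simp add: divide_inverse mult.commute)
    then have "(\<Sum>i<Suc k. real k ^ i / fact i) \<le> (\<Sum>i. real k ^ i / fact i)"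
      by (intro sum_le_suminf) (auto simp: sums_iff)
    then show ?thesis using s by (simp add: sums_iff)
  qed
  finally have 1: "real k ^ k \<le> exp 1 ^ k * fact k"
    by (simp add: field_simps exp_of_nat_mult[symmetric])
  have "real (n choose k) * fact k = real ((n choose k) * fact k)" by simp
  also have "\<dots> \<le> real (n ^ k)"
    by (intro of_nat_mono) (rule binomial_fact_pow)
  finally have 2: "real (n choose k) * fact k \<le> real n ^ k" by simp
  have "real (n choose k) * real k ^ k \<le> real (n choose k) * (exp 1 ^ k * fact k)"
    by (intro mult_left_mono 1) auto
  also have "\<dots> \<le> exp 1 ^ k * real n ^ k"
    using mult_left_mono[OF 2, of "exp 1 ^ k"] by (simp add: mult_ac)
  finally show ?thesis using assms by (simp add: power_divide power_mult_distrib field_simps)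
qed

text \<open>A dense set contains exactly \<open>m\<close> chosen edges of the graph, so the union
  bound runs over the sets \<open>S\<close> and over the \<open>m\<close>-element sets of pairs
  inside \<open>S\<close>. The number of pairs is bounded crudely by \<open>s * s\<close>.\<close>

lemma card_dense_le:
  assumes n: "2 * d + 2 * d * d \<le> n" and d: "d \<ge> 3" and m: "4 * m \<le> n"
  shows "real (card {E \<in> regular_graphs n d. \<exists>S\<subseteq>{1..n}. card S = s \<and> m \<le> card (induced E S)})
    \<le> real (n choose s) * real ((s * s) choose m) * (real (d * d) / real n) ^ m
       * real (card (regular_graphs n d))" (is "real (card ?B) \<le> _")
proof -
  define SS where "SS = {S. S \<subseteq> {1..n} \<and> card S = s}"
  define FF where "FF S = {F. F \<subseteq> all_edges n \<inter> Pow S \<and> card F = m}" for S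
  define r where "r = (real (d * d) / real n) ^ m * real (card (regular_graphs n d))"
  have r0: "r \<ge> 0" unfolding r_def by simp
  have finSS: "finite SS" unfolding SS_def by simp
  have finFF: "finite (FF S)" for S
    by (rule finite_subset[of _ "Pow (all_edges n)"]) (auto simp: FF_def finite_all_edges)
  have "?B \<subseteq> (\<Union>S\<in>SS. \<Union>F\<in>FF S. regular_containing n d F)"
  proof
    fix E assume "E \<in> ?B"
    then obtain S where E: "E \<in> regular_graphs n d" and S: "S \<in> SS" and m: "m \<le> card (induced E S)"
      unfolding SS_def by blast
    obtain F where F: "F \<subseteq> induced E S" "card F = m"
      using m obtain_subset_with_card_n by metis
    have "E \<subseteq> all_edges n" using E by (simp add: regular_graphs_def)
    then have "F \<in> FF S" "E \<in> regular_containing n d F"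
      using F E unfolding FF_def regular_containing_def induced_def by auto
    with S show "E \<in> (\<Union>S\<in>SS. \<Union>F\<in>FF S. regular_containing n d F)" by blast
  qed
  then have "card ?B \<le> card (\<Union>S\<in>SS. \<Union>F\<in>FF S. regular_containing n d F)"
    by (rule card_mono[rotated]) (use finSS finFF finite_regular_containing in auto)
  also have "\<dots> \<le> (\<Sum>S\<in>SS. card (\<Union>F\<in>FF S. regular_containing n d F))"
    by (rule card_UN_le[OF finSS])
  also have "\<dots> \<le> (\<Sum>S\<in>SS. \<Sum>F\<in>FF S. card (regular_containing n d F))"
    by (intro sum_mono card_UN_le finFF)
  finally have "real (card ?B) \<le> (\<Sum>S\<in>SS. \<Sum>F\<in>FF S. real (card (regular_containing n d F)))"
    by (simp only: of_nat_sum[symmetric] of_nat_le_iff)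
  also have "\<dots> \<le> (\<Sum>S\<in>SS. \<Sum>F\<in>FF S. r)"
  proof (intro sum_mono)
    fix S F assume "F \<in> FF S"
    then have F: "card F = m" "finite F"
      unfolding FF_def by (auto intro: finite_subset[OF _ finite_all_edges])
    show "real (card (regular_containing n d F)) \<le> r"
      using card_regular_containing_le[OF n d F(2)] m F(1) unfolding r_def by simp
  qed
  also have "\<dots> \<le> (\<Sum>S\<in>SS. real ((s * s) choose m) * r)"
  proof (intro sum_mono)
    fix S assume "S \<in> SS"
    then have S: "finite S" "card S = s" unfolding SS_def by (auto intro: finite_subset)
    have fin: "finite (all_edges n \<inter> Pow S)" using finite_all_edges by blast
    have "all_edges n \<inter> Pow S \<subseteq> (\<lambda>(x, y). {x, y}) ` (S \<times> S)"
      unfolding all_edges_def by auto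
    then have "card (all_edges n \<inter> Pow S) \<le> card ((\<lambda>(x, y). {x, y}) ` (S \<times> S))"
      by (rule card_mono[rotated]) (use S in auto)
    also have "\<dots> \<le> card (S \<times> S)" by (rule card_image_le) (use S in auto)
    finally have c: "card (all_edges n \<inter> Pow S) \<le> s * s" using S by (simp add: card_cartesian_product)
    have "card (FF S) = card (all_edges n \<inter> Pow S) choose m"
      unfolding FF_def by (rule n_subsets[OF fin])
    also have "\<dots> \<le> (s * s) choose m" by (rule binomial_right_mono[OF c])
    finally have "real (card (FF S)) \<le> real ((s * s) choose m)" by simp
    then show "(\<Sum>F\<in>FF S. r) \<le> real ((s * s) choose m) * r"
      using r0 by (simp add: mult_right_mono)
  qed
  also have "\<dots> = real (n choose s) * real ((s * s) choose m) * r"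
    using n_subsets[of "{1..n}" s] by (simp add: SS_def)
  finally show ?thesis unfolding r_def by (simp add: mult_ac)
qed

text \<open>With excess \<open>k\<close> the union bound over the sets of size \<open>s\<close> and their \<open>s + k\<close> edges is of the form
  \<open>const ^ s * (const * s / n) ^ k\<close>, so that \<open>k\<close> of order \<open>s / ln n\<close> is enough to beat the first factor.\<close>

lemma dense_union_bound:
  fixes d n s k :: nat
  defines "A \<equiv> exp 1 * real (d * d)"
  assumes d: "d \<ge> 1" and s: "s \<ge> 1" "real s \<le> real n powr (2/3)" and n: "n \<ge> 2"
    and A: "A \<le> real n powr (1/12)"
    and k: "k \<ge> 1" "8 * ln (2 * exp 1 * A) / ln (real n) * real s \<le> real k"
  shows "real (n choose s) * real ((s * s) choose (s + k)) * (real (d * d) / real n) ^ (s + k)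
    \<le> real n powr (-1/8) * (1/2) ^ s"
proof -
  have d1: "real (d * d) \<ge> 1" using d by (cases d) auto
  then have A1: "A \<ge> 1" unfolding A_def using mult_mono[of 1 "exp 1" 1 "real (d*d)"] by simp
  have n0: "real n > 0" and s0: "real s > 0" and ln0: "ln (real n) > 0" using n s by auto
  have "exp 1 * real (s * s) / real (s + k) \<le> exp 1 * real (s * s) / real s"
    using s0 by (intro divide_left_mono) auto
  also have "\<dots> = exp 1 * real s" using s0 by simp
  finally have e: "exp 1 * real (s * s) / real (s + k) \<le> exp 1 * real s" .
  have "real ((s * s) choose (s + k)) \<le> (exp 1 * real (s * s) / real (s + k)) ^ (s + k)"
    using s by (intro choose_le_exp) auto
  also have "\<dots> \<le> (exp 1 * real s) ^ (s + k)"
    by (intro power_mono e) auto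
  finally have c2: "real ((s * s) choose (s + k)) \<le> (exp 1 * real s) ^ (s + k)" .
  have c1: "real (n choose s) \<le> (exp 1 * real n / real s) ^ s"
    using s by (intro choose_le_exp) auto
  \<comment> \<open>The exponents add up to \<open>1/12 + 2/3 - 1 = -1/4\<close>, so every surplus
    edge gains a factor \<open>n powr (-1/4)\<close>.\<close>
  have As: "A * real s / real n \<le> real n powr (-1/4)"
  proof -
    have "A * real s \<le> real n powr (1/12) * real n powr (2/3)"
      using A1 by (intro mult_mono A s) auto
    then have "A * real s / real n \<le> real n powr (1/12) * real n powr (2/3) / real n powr 1"
      using n0 by (simp add: divide_right_mono)
    also have "\<dots> = real n powr (-1/4)"
      by (simp only: powr_add[symmetric] powr_diff[symmetric]) simp
    finally show ?thesis .
  qed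
  have "real (n choose s) * real ((s * s) choose (s + k)) * (real (d * d) / real n) ^ (s + k)
     \<le> (exp 1 * real n / real s) ^ s * (exp 1 * real s) ^ (s + k) * (real (d * d) / real n) ^ (s + k)"
    by (intro mult_right_mono mult_mono c1 c2) auto
  also have "\<dots> = (exp 1 * real n / real s) ^ s * (A * real s / real n) ^ (s + k)"
    unfolding A_def by (simp add: power_mult_distrib power_divide mult_ac)
  also have "\<dots> = ((exp 1 * real n / real s) * (A * real s / real n)) ^ s * (A * real s / real n) ^ k"
    by (simp only: power_add power_mult_distrib mult.assoc)
  also have "(exp 1 * real n / real s) * (A * real s / real n) = exp 1 * A"
    using n0 s0 by simp
  also have "(exp 1 * A) ^ s * (A * real s / real n) ^ k \<le> (exp 1 * A) ^ s * (real n powr (-1/4)) ^ k"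
    using A1 by (intro mult_left_mono power_mono As) auto
  also have "(real n powr (-1/4)) ^ k = real n powr (- real k / 4)"
    using n0 by (simp add: powr_powr powr_realpow[symmetric])
  \<comment> \<open>Split \<open>k / 4\<close> into two halves: \<open>k \<ge> 1\<close> turns one
    into \<open>n powr (-1/8)\<close>, and the second bound on \<open>k\<close> turns the other into
    \<open>(2 * exp 1 * A) ^ s\<close> in the denominator, which absorbs the number of choices and
    leaves \<open>(1/2) ^ s\<close>.\<close>
  also have "\<dots> \<le> real n powr (- 1/8 - ln (2 * exp 1 * A) / ln (real n) * real s)"
  proof (rule powr_mono)
    have "real k \<ge> 1" using k by simp
    then show "- real k / 4 \<le> - 1/8 - ln (2 * exp 1 * A) / ln (real n) * real s" using k(2) by simp
  qed (use n in simp)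
  also have "\<dots> = real n powr (-1/8) * exp (- (ln (2 * exp 1 * A) * real s))"
    using n0 ln0 by (simp add: powr_def exp_add[symmetric] algebra_simps)
  also have "exp (- (ln (2 * exp 1 * A) * real s)) = (1 / (2 * exp 1 * A)) ^ s"
  proof -
    have "exp (- (ln (2 * exp 1 * A) * real s)) = exp (real s * - ln (2 * exp 1 * A))"
      by (simp add: mult_ac)
    also have "\<dots> = exp (- ln (2 * exp 1 * A)) ^ s" by (rule exp_of_nat_mult)
    also have "exp (- ln (2 * exp 1 * A)) = 1 / (2 * exp 1 * A)"
    proof -
      have "2 * exp 1 * A > 0" using A1 by simp
      then show ?thesis by (simp only: exp_minus exp_ln inverse_eq_divide)
    qed
    finally show ?thesis .
  qed
  finally have "real (n choose s) * real ((s * s) choose (s + k)) * (real (d * d) / real n) ^ (s + k)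
     \<le> (exp 1 * A) ^ s * (real n powr (-1/8) * (1 / (2 * exp 1 * A)) ^ s)"
    using A1 by (simp add: mult_left_mono)
  also have "\<dots> = real n powr (-1/8) * ((exp 1 * A) * (1 / (2 * exp 1 * A))) ^ s"
    by (simp only: power_mult_distrib mult_ac)
  also have "(exp 1 * A) * (1 / (2 * exp 1 * A)) = 1/2" using A1 by simp
  finally show ?thesis .
qed

text \<open>The exponent \<open>2/3\<close> lies above \<open>1/2\<close>, to admit balls with about
  \<open>sqrt n * ln n\<close> vertices, and below 1, so that a surplus edge in the union bound
  still gains a power of \<open>n\<close>.\<close>

definition sparse :: "nat \<Rightarrow> real \<Rightarrow> nat set set \<Rightarrow> bool" where
  "sparse n \<eta> E \<longleftrightarrow> (\<forall>S\<subseteq>{1..n}. real (card S) \<le> real n powr (2/3) \<longrightarrow>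
     real (card (induced E S)) \<le> (1 + \<eta>) * real (card S))"

lemma card_not_sparse_le:
  fixes d n :: nat
  defines "A \<equiv> exp 1 * real (d * d)"
  defines "\<eta> \<equiv> 8 * ln (2 * exp 1 * A) / ln (real n)"
  assumes d: "d \<ge> 3" and n: "2 * d + 2 * d * d \<le> n" "8 * real n powr (2/3) \<le> real n"
    and A: "A \<le> real n powr (1/12)" and \<eta>: "\<eta> \<le> 1"
  shows "real (card {E \<in> regular_graphs n d. \<not> sparse n \<eta> E})
    \<le> real n powr (-1/8) * real (card (regular_graphs n d))"
proof -
  define R where "R = real (card (regular_graphs n d))"
  have n2: "n \<ge> 2" using n d by simp
  have "real (d * d) \<ge> 1" using d by (cases d) auto
  then have A1: "A \<ge> 1" unfolding A_def using mult_mono[of 1 "exp 1" 1 "real (d*d)"] by simp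
  moreover have "2 * exp (1 :: real) \<ge> 1" using exp_ge_add_one_self[of 1] by linarith
  ultimately have "2 * exp 1 * A \<ge> 1" using mult_mono[of 1 "2 * exp 1" 1 A] by simp
  then have \<eta>0: "\<eta> \<ge> 0" unfolding \<eta>_def using n2 by simp
  \<comment> \<open>More than \<open>(1 + \<eta>) * s\<close> edges means that the excess over
    \<open>s\<close> is a positive integer that is at least \<open>\<eta> * s\<close>.\<close>
  define k where "k s = max 1 (nat \<lceil>\<eta> * real s\<rceil>)" for s :: nat
  define T where "T = {s. 1 \<le> s \<and> s \<le> n \<and> real s \<le> real n powr (2/3)}"
  have finT: "finite T" by (rule finite_subset[of _ "{..n}"]) (auto simp: T_def)
  define B where "B s = {E \<in> regular_graphs n d. \<exists>S\<subseteq>{1..n}. card S = s \<and> s + k s \<le> card (induced E S)}" for s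
  have "{E \<in> regular_graphs n d. \<not> sparse n \<eta> E} \<subseteq> (\<Union>s\<in>T. B s)"
  proof
    fix E assume "E \<in> {E \<in> regular_graphs n d. \<not> sparse n \<eta> E}"
    then obtain S where E: "E \<in> regular_graphs n d" and S: "S \<subseteq> {1..n}" "real (card S) \<le> real n powr (2/3)"
      and gt: "real (card (induced E S)) > (1 + \<eta>) * real (card S)"
      unfolding sparse_def by auto
    define s where "s = card S"
    have "S \<noteq> {}"
    proof
      assume "S = {}"
      moreover have "{} \<notin> E"
        using E unfolding regular_graphs_def all_edges_def by auto
      ultimately have "induced E S = {}" by (auto simp: induced_def)
      with gt \<open>S = {}\<close> show False by simp
    qed
    with S have s1: "s \<ge> 1" unfolding s_def by (simp add: Suc_le_eq card_gt_0_iff finite_subset)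
    have sn: "s \<le> n" unfolding s_def using card_mono[OF _ S(1)] by simp
    define c where "c = card (induced E S)"
    have gt': "real c > real s + \<eta> * real s" using gt by (simp add: c_def s_def algebra_simps)
    moreover have "\<eta> * real s \<ge> 0" using \<eta>0 by simp
    ultimately have sc: "s < c" by linarith
    with gt' have "\<eta> * real s \<le> real (c - s)" by (simp add: of_nat_diff)
    then have "nat \<lceil>\<eta> * real s\<rceil> \<le> c - s" by (simp add: nat_le_iff ceiling_le_iff)
    with sc have "k s \<le> c - s" unfolding k_def by (intro max.boundedI) linarith+
    with sc have "s + k s \<le> c" by linarith
    then have "E \<in> B s" using E S(1) by (auto simp: B_def s_def c_def)
    moreover have "s \<in> T" using s1 sn S(2) by (simp add: T_def s_def)
    ultimately show "E \<in> (\<Union>s\<in>T. B s)" by blast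
  qed
  then have "card {E \<in> regular_graphs n d. \<not> sparse n \<eta> E} \<le> card (\<Union>s\<in>T. B s)"
    by (rule card_mono[rotated]) (auto simp: finT B_def finite_regular_graphs)
  also have "\<dots> \<le> (\<Sum>s\<in>T. card (B s))" by (rule card_UN_le[OF finT])
  finally have "real (card {E \<in> regular_graphs n d. \<not> sparse n \<eta> E}) \<le> (\<Sum>s\<in>T. real (card (B s)))"
    by (simp only: of_nat_sum[symmetric] of_nat_le_iff)
  also have "\<dots> \<le> (\<Sum>s\<in>T. real n powr (-1/8) * (1/2) ^ s * R)"
  proof (intro sum_mono)
    fix s assume s: "s \<in> T"
    \<comment> \<open>From \<open>\<eta> \<le> 1\<close> the excess is at most \<open>s\<close>, so
      at most \<open>2 * s\<close> edges are prescribed and \<open>8 * s \<le> n\<close>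
      suffices.\<close>
    have "\<eta> * real s \<le> 1 * real s" by (intro mult_right_mono \<eta>) auto
    then have "nat \<lceil>\<eta> * real s\<rceil> \<le> s" by (simp add: nat_le_iff ceiling_le_iff)
    then have ks: "k s \<le> s" using s by (simp add: k_def T_def)
    have "real (8 * s) \<le> real n" using s n(2) by (simp add: T_def)
    then have "8 * s \<le> n" by (simp only: of_nat_le_iff)
    with ks have m: "4 * (s + k s) \<le> n" by simp
    have "real (card (B s)) \<le> real (n choose s) * real ((s * s) choose (s + k s))
        * (real (d * d) / real n) ^ (s + k s) * R"
      unfolding B_def R_def by (rule card_dense_le[OF n(1) d m])
    also have "\<dots> \<le> (real n powr (-1/8) * (1/2) ^ s) * R"
    proof (intro mult_right_mono dense_union_bound)
      have "\<eta> * real s \<le> real (k s)" unfolding k_def by linarith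
      then show "8 * ln (2 * exp 1 * (exp 1 * real (d * d))) / ln (real n) * real s \<le> real (k s)"
        by (simp add: \<eta>_def A_def)
    qed (use s n2 d A in \<open>auto simp: T_def A_def k_def R_def\<close>)
    finally show "real (card (B s)) \<le> real n powr (-1/8) * (1/2) ^ s * R" .
  qed
  also have "\<dots> = (\<Sum>s\<in>T. (1/2) ^ s) * (real n powr (-1/8) * R)"
    unfolding sum_distrib_right by (simp only: mult_ac)
  also have "(\<Sum>s\<in>T. (1/2 :: real) ^ s) \<le> 1"
  proof -
    have "(\<Sum>s\<in>T. (1/2 :: real) ^ s) \<le> (\<Sum>s\<in>{1..n}. (1/2) ^ s)"
      by (rule sum_mono2) (auto simp: T_def)
    also have "\<dots> \<le> 1"
    proof -
      have "(\<Sum>s\<in>{1..n}. (1/2 :: real) ^ s) = 1 - (1/2) ^ n" by (induction n) auto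
      then show ?thesis by simp
    qed
    finally show ?thesis .
  qed
  finally show ?thesis unfolding R_def by (simp add: mult_right_mono)
qed

section \<open>Balls\<close>

primrec gball :: "nat set set \<Rightarrow> nat \<Rightarrow> nat \<Rightarrow> nat set" where
  "gball E a 0 = {a}"
| "gball E a (Suc r) = gball E a r \<union> (\<Union>u\<in>gball E a r. nbrs E u)"

lemma gball_Suc_mono: "gball E a r \<subseteq> gball E a (Suc r)"
  by auto

lemma gball_mono: "i \<le> j \<Longrightarrow> gball E a i \<subseteq> gball E a j"
  by (rule lift_Suc_mono_le[of "gball E a"]) (rule gball_Suc_mono)

lemma gball_step: "u \<in> gball E a r \<Longrightarrow> {u, x} \<in> E \<Longrightarrow> x \<in> gball E a (Suc r)"
  by (auto simp: mem_nbrs)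

lemma gball_trans: "y \<in> gball E x j \<Longrightarrow> x \<in> gball E a i \<Longrightarrow> y \<in> gball E a (i + j)"
proof (induction j arbitrary: y)
  case (Suc j)
  then show ?case by (auto simp: mem_nbrs)
qed auto

lemma gball_sym: "y \<in> gball E x r \<Longrightarrow> x \<in> gball E y r"
proof (induction r arbitrary: y)
  case (Suc r)
  show ?case
  proof (cases "y \<in> gball E x r")
    case True
    then show ?thesis using Suc.IH gball_Suc_mono[of E y r] by auto
  next
    case False
    with Suc.prems obtain u where u: "u \<in> gball E x r" "{u, y} \<in> E" by (auto simp: mem_nbrs)
    have "u \<in> gball E y 1" using u(2) by (simp add: mem_nbrs insert_commute)
    from gball_trans[OF Suc.IH[OF u(1)] this] show ?thesis by (simp only: plus_1_eq_Suc)
  qed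
qed auto

text \<open>Only vertices at distance less than \<open>r\<close> are expanded, so those at distance
  exactly \<open>r\<close> may change their neighbours.\<close>

lemma gball_cong:
  assumes "\<And>v i. i < r \<Longrightarrow> v \<in> gball E a i \<Longrightarrow> nbrs E' v = nbrs E v" "i \<le> r"
  shows "gball E' a i = gball E a i"
  using assms(2)
proof (induction i)
  case (Suc i)
  then have "(\<Union>v\<in>gball E a i. nbrs E' v) = (\<Union>v\<in>gball E a i. nbrs E v)"
    using assms(1)[of i] by (intro SUP_cong) auto
  with Suc show ?case by simp
qed simp

section \<open>Walks and distances\<close>

lemma walk_in_gball:
  assumes "is_walk E p" "i < length p"
  shows "p ! i \<in> gball E (hd p) i"
  using assms(2)
proof (induction i)
  case 0
  then show ?case by (simp add: hd_conv_nth)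
next
  case (Suc i)
  then have "{p ! i, p ! Suc i} \<in> E" using assms(1) by (simp add: is_walk_def)
  with Suc show ?case by (intro gball_step) auto
qed

lemma walk_to_end_in_gball:
  assumes "is_walk E p" "i < length p"
  shows "last p \<in> gball E (p ! i) (length p - 1 - i)"
proof -
  have "is_walk E (drop i p)" using assms by (auto simp: is_walk_def)
  then have "drop i p ! (length p - 1 - i) \<in> gball E (hd (drop i p)) (length p - 1 - i)"
    using assms(2) by (intro walk_in_gball) auto
  moreover have "drop i p ! (length p - 1 - i) = last p"
    using assms by (subst last_conv_nth) auto
  ultimately show ?thesis using assms(2) by (simp add: hd_drop_conv_nth)
qed

lemma gball_walk:
  "y \<in> gball E a r \<Longrightarrow> \<exists>p\<in>walks E a y. length p \<le> Suc r"
proof (induction r arbitrary: y)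
  case 0
  then show ?case by (intro bexI[of _ "[a]"]) (auto simp: walks_def is_walk_def)
next
  case (Suc r)
  show ?case
  proof (cases "y \<in> gball E a r")
    case True
    with Suc.IH show ?thesis by (meson le_SucI)
  next
    case False
    with Suc.prems obtain u where u: "u \<in> gball E a r" "{u, y} \<in> E" by (auto simp: mem_nbrs)
    obtain p where p: "p \<in> walks E a u" "length p \<le> Suc r" using Suc.IH[OF u(1)] by blast
    have ne: "p \<noteq> []" using p by (auto simp: walks_def is_walk_def)
    have lastp: "p ! (length p - 1) = u" using p ne by (simp add: walks_def last_conv_nth)
    have "is_walk E (p @ [y])"
      unfolding is_walk_def
    proof (intro conjI allI impI)
      fix i assume i: "Suc i < length (p @ [y])"
      show "{(p @ [y]) ! i, (p @ [y]) ! Suc i} \<in> E"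
      proof (cases "Suc i < length p")
        case True
        then show ?thesis using p by (auto simp: walks_def is_walk_def nth_append)
      next
        case False
        with i have "i = length p - 1" "Suc i = length p" by auto
        then show ?thesis using u lastp ne by (simp add: nth_append)
      qed
    qed simp
    then have "p @ [y] \<in> walks E a y" using p ne by (auto simp: walks_def)
    then show ?thesis using p by (intro bexI[of _ "p @ [y]"]) auto
  qed
qed

section \<open>Growth of balls in regular graphs, and traffic from the diameter\<close>

context
  fixes n d :: nat and E :: "nat set set"
  assumes E: "E \<in> regular_graphs n d"
begin

lemma gball_subset: "a \<in> {1..n} \<Longrightarrow> gball E a r \<subseteq> {1..n}"
  using nbrs_subset_regular[OF E] by (induction r) auto

lemma finite_gball: "finite (gball E a r)"
  using finite_nbrs_regular[OF E] by (induction r) auto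

text \<open>A vertex of a sphere of positive radius has a neighbour in the previous ball, so at most
  \<open>d - 1\<close> of its neighbours are new.\<close>

lemma card_sphere_le:
  assumes "d \<ge> 1"
  shows "card (gball E a (Suc r) - gball E a r) \<le> d * (d - 1) ^ r"
proof (induction r)
  case 0
  have "card (gball E a 1 - gball E a 0) \<le> card (nbrs E a)"
    by (rule card_mono[OF finite_nbrs_regular[OF E]]) auto
  then show ?case using card_nbrs_regular_le[OF E, of a] by simp
next
  case (Suc r)
  let ?S = "gball E a (Suc r) - gball E a r"
  have finS: "finite ?S" using finite_gball by blast
  have "gball E a (Suc (Suc r)) - gball E a (Suc r) \<subseteq> (\<Union>u\<in>?S. nbrs E u - gball E a r)"
  proof
    fix x assume x: "x \<in> gball E a (Suc (Suc r)) - gball E a (Suc r)"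
    then have "x \<in> (\<Union>u\<in>gball E a (Suc r). nbrs E u)"
      unfolding gball.simps(2)[of E a "Suc r"] by blast
    then obtain u where u: "u \<in> gball E a (Suc r)" "{u, x} \<in> E"
      unfolding mem_nbrs[symmetric] by blast
    with x have "u \<notin> gball E a r" using gball_step by blast
    with u x show "x \<in> (\<Union>u\<in>?S. nbrs E u - gball E a r)"
      using gball_Suc_mono[of E a r] by (auto simp: mem_nbrs)
  qed
  then have "card (gball E a (Suc (Suc r)) - gball E a (Suc r)) \<le> card (\<Union>u\<in>?S. nbrs E u - gball E a r)"
    by (rule card_mono[rotated]) (use finS finite_nbrs_regular[OF E] in auto)
  also have "\<dots> \<le> (\<Sum>u\<in>?S. card (nbrs E u - gball E a r))" by (rule card_UN_le[OF finS])
  also have "\<dots> \<le> (\<Sum>u\<in>?S. d - 1)"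
  proof (rule sum_mono)
    fix u assume u: "u \<in> ?S"
    then obtain w where w: "w \<in> gball E a r" "w \<in> nbrs E u" by (auto simp: nbrs_sym)
    then have "nbrs E u - gball E a r \<subseteq> nbrs E u - {w}" by blast
    then have "card (nbrs E u - gball E a r) \<le> card (nbrs E u - {w})"
      by (rule card_mono[rotated]) (use finite_nbrs_regular[OF E] in auto)
    also have "\<dots> = card (nbrs E u) - 1" using w finite_nbrs_regular[OF E] by simp
    also have "\<dots> \<le> d - 1" using card_nbrs_regular_le[OF E, of u] by simp
    finally show "card (nbrs E u - gball E a r) \<le> d - 1" .
  qed
  also have "\<dots> = card ?S * (d - 1)" by simp
  also have "\<dots> \<le> (d * (d - 1) ^ r) * (d - 1)" by (intro mult_right_mono Suc.IH) simp
  finally show ?case by (simp add: mult_ac)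
qed

lemma card_gball_le:
  assumes "d \<ge> 3"
  shows "card (gball E a r) \<le> 4 * (d - 1) ^ r"
proof (induction r)
  case (Suc r)
  have "gball E a (Suc r) = gball E a r \<union> (gball E a (Suc r) - gball E a r)"
    using gball_Suc_mono[of E a r] by blast
  then have "card (gball E a (Suc r)) \<le> card (gball E a r) + card (gball E a (Suc r) - gball E a r)"
    by (metis card_Un_le)
  also have "\<dots> \<le> 4 * (d - 1) ^ r + d * (d - 1) ^ r"
    using assms by (intro add_mono Suc.IH card_sphere_le) simp
  also have "\<dots> = (4 + d) * (d - 1) ^ r" by (simp add: algebra_simps)
  \<comment> \<open>\<open>4 + d \<le> 4 * (d - 1)\<close> holds from \<open>d = 3\<close> on, which
    is what allows the constant 4.\<close>
  also have "\<dots> \<le> (4 * (d - 1)) * (d - 1) ^ r" using assms by (intro mult_right_mono) auto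
  finally show ?case by (simp add: mult_ac)
qed simp

text \<open>An edge meeting the ball of radius \<open>r\<close> lies in the ball of radius \<open>Suc r\<close>, and it is counted twice
  in the degree sum over the smaller ball only if it lies in the smaller ball.\<close>

lemma gball_edge_count:
  assumes a: "a \<in> {1..n}"
  shows "d * card (gball E a r) \<le> card (induced E (gball E a (Suc r))) + card (induced E (gball E a r))"
proof -
  let ?B = "gball E a r" and ?B' = "gball E a (Suc r)"
  define I where "I = induced E ?B'"
  have finI: "finite I" unfolding I_def induced_def using finite_regular[OF E] by simp
  have "d * card ?B = (\<Sum>u\<in>?B. d)" by simp
  also have "\<dots> = (\<Sum>u\<in>?B. \<Sum>e\<in>I. if u \<in> e then 1 else 0)"
  proof (rule sum.cong[OF refl])
    fix u assume u: "u \<in> ?B"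
    have "{e \<in> E. u \<in> e} = {e \<in> I. u \<in> e}"
    proof -
      have "e \<subseteq> ?B'" if e: "e \<in> E" "u \<in> e" for e
      proof -
        have "e \<in> all_edges n" using E e(1) by (auto simp: regular_graphs_def)
        then obtain x y where xy: "e = {x, y}" unfolding all_edges_def by blast
        have "\<exists>z. e = {u, z}" using e(2) xy by auto
        then obtain z where "e = {u, z}" by blast
        with e(1) u show ?thesis using gball_step[of u E a r z] gball_Suc_mono[of E a r] by auto
      qed
      then show ?thesis by (auto simp: I_def induced_def)
    qed
    moreover have "degree E u = d" using E u gball_subset[OF a, of r] by (auto simp: regular_graphs_def)
    ultimately have "d = card {e \<in> I. u \<in> e}" by (simp add: degree_def)
    also have "\<dots> = (\<Sum>e\<in>I. if u \<in> e then 1 else 0)"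
      using finI by (simp add: sum.If_cases Int_def)
    finally show "d = (\<Sum>e\<in>I. if u \<in> e then 1 else 0)" .
  qed
  also have "\<dots> = (\<Sum>e\<in>I. \<Sum>u\<in>?B. if u \<in> e then 1 else 0)" by (rule sum.swap)
  also have "\<dots> = (\<Sum>e\<in>I. card (?B \<inter> e))"
    using finite_gball by (simp add: sum.If_cases Int_def)
  also have "\<dots> \<le> (\<Sum>e\<in>I. 1 + (if e \<subseteq> ?B then 1 else 0))"
  proof (rule sum_mono)
    fix e assume "e \<in> I"
    then have "e \<in> all_edges n" using E by (auto simp: I_def induced_def regular_graphs_def)
    then obtain x y where e: "e = {x, y}" "x \<noteq> y" unfolding all_edges_def by blast
    then have c2: "finite e" "card e = 2" by auto
    show "card (?B \<inter> e) \<le> 1 + (if e \<subseteq> ?B then 1 else 0)"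
    proof (cases "e \<subseteq> ?B")
      case True
      then show ?thesis using c2 by (simp add: Int_absorb1)
    next
      case False
      then have "?B \<inter> e \<subset> e" by blast
      then have "card (?B \<inter> e) < 2" using psubset_card_mono[OF c2(1)] c2(2) by metis
      then show ?thesis by simp
    qed
  qed
  also have "\<dots> = card I + card {e \<in> I. e \<subseteq> ?B}"
    using finI by (subst sum.distrib) (simp add: sum.If_cases Int_def)
  also have "{e \<in> I. e \<subseteq> ?B} = induced E ?B"
    using gball_Suc_mono[of E a r] by (auto simp: I_def induced_def)
  finally show ?thesis by (simp add: I_def)
qed

text \<open>Since \<open>\<eta>\<close> will be of order \<open>1 / ln n\<close> and there are only \<open>O(ln n)\<close> steps, the factor lost
  in each step accumulates to a constant.\<close>

lemma gball_growth:
  assumes a: "a \<in> {1..n}" and d: "d \<ge> 3" and sp: "sparse n \<eta> E" and \<eta>: "0 \<le> \<eta>" "\<eta> \<le> 1/8"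
    and small: "4 * real (d - 1) ^ Suc r \<le> real n powr (2/3)"
  shows "real (card (gball E a (Suc r))) \<ge> real (d - 1) * exp (- 4 * \<eta>) * real (card (gball E a r))"
    and "real (card (gball E a (Suc r) - gball E a r)) \<ge> real (card (gball E a r)) / 2"
proof -
  define b where "b = real (card (gball E a r))"
  define b' where "b' = real (card (gball E a (Suc r)))"
  define q where "q = real (d - 1)"
  have q2: "q \<ge> 2" and dq: "real d = q + 1" using d by (auto simp: q_def)
  have b0: "b \<ge> 0" unfolding b_def by simp
  have sub: "gball E a r \<subseteq> gball E a (Suc r)" by (rule gball_Suc_mono)
  have "b' \<le> real (4 * (d - 1) ^ Suc r)"
    unfolding b'_def by (intro of_nat_mono card_gball_le d)
  then have b's: "b' \<le> real n powr (2/3)" using small by simp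
  have "b \<le> b'" unfolding b_def b'_def by (intro of_nat_mono card_mono finite_gball sub)
  with b's have bs: "b \<le> real n powr (2/3)" by simp
  have "real (d * card (gball E a r)) \<le> real (card (induced E (gball E a (Suc r))) + card (induced E (gball E a r)))"
    by (intro of_nat_mono gball_edge_count a)
  also have "\<dots> \<le> (1 + \<eta>) * b' + (1 + \<eta>) * b"
    using sp bs b's gball_subset[OF a] unfolding sparse_def b_def b'_def
    by (simp only: of_nat_add) (intro add_mono; blast)
  finally have key: "(1 + \<eta>) * b' \<ge> (q - \<eta>) * b" using dq by (simp add: b_def algebra_simps)
  \<comment> \<open>This says \<open>(q - \<eta>) / (1 + \<eta>) \<ge> q * (1 - 2 * \<eta>)\<close>.
    Below, \<open>1 - 2 * \<eta>\<close> is replaced by \<open>exp (- 4 * \<eta>)\<close>, which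
    multiplies conveniently over many steps.\<close>
  have "(q * (1 - 2 * \<eta>)) * (1 + \<eta>) \<le> q - \<eta>"
  proof -
    have "q * (1 - 2 * \<eta>) * (1 + \<eta>) = q - q * \<eta> - 2 * q * \<eta>\<^sup>2"
      by (simp add: algebra_simps power2_eq_square)
    moreover have "q * \<eta> \<ge> 1 * \<eta>" using q2 \<eta> by (intro mult_right_mono) auto
    moreover have "2 * q * \<eta>\<^sup>2 \<ge> 0" using q2 by simp
    ultimately show ?thesis by linarith
  qed
  then have "(q * (1 - 2 * \<eta>)) * (1 + \<eta>) * b \<le> (1 + \<eta>) * b'"
    using mult_right_mono[OF _ b0] key by (meson order.trans)
  then have g: "q * (1 - 2 * \<eta>) * b \<le> b'"
    using \<eta> by (simp add: mult_ac)
  have "exp (4 * \<eta>) \<ge> 1 + 4 * \<eta>" using exp_ge_add_one_self[of "4 * \<eta>"] by linarith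
  moreover have "(1 + 4 * \<eta>) * (1 - 2 * \<eta>) \<ge> 1"
  proof -
    have "\<eta> * (2 - 8 * \<eta>) \<ge> 0" using \<eta> by (intro mult_nonneg_nonneg) auto
    then show ?thesis by (simp add: algebra_simps)
  qed
  moreover have "(1 + 4 * \<eta>) * (1 - 2 * \<eta>) \<le> exp (4 * \<eta>) * (1 - 2 * \<eta>)"
    using calculation(1) \<eta> by (intro mult_right_mono) auto
  ultimately have "exp (4 * \<eta>) * (1 - 2 * \<eta>) \<ge> 1" by linarith
  then have "exp (- 4 * \<eta>) \<le> 1 - 2 * \<eta>"
    by (simp add: exp_minus field_simps)
  then have "q * exp (- 4 * \<eta>) * b \<le> q * (1 - 2 * \<eta>) * b"
    using q2 b0 by (intro mult_right_mono mult_left_mono) auto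
  with g show "real (card (gball E a (Suc r))) \<ge> real (d - 1) * exp (- 4 * \<eta>) * real (card (gball E a r))"
    unfolding b_def b'_def q_def by linarith
  \<comment> \<open>By \<open>q \<ge> 2\<close> and \<open>\<eta> \<le> 1/8\<close> the ball grows
    at least by the factor \<open>3/2\<close>.\<close>
  have "2 * (3/4) \<le> q * (1 - 2 * \<eta>)" using q2 \<eta> by (intro mult_mono) auto
  then have "(3/2) * b \<le> q * (1 - 2 * \<eta>) * b" using b0 by (intro mult_right_mono) auto
  with g have "b' - b \<ge> b / 2" by linarith
  moreover have "real (card (gball E a (Suc r) - gball E a r)) = b' - b"
    using \<open>b \<le> b'\<close> sub finite_gball by (simp add: card_Diff_subset b_def b'_def of_nat_diff)
  ultimately show "real (card (gball E a (Suc r) - gball E a r)) \<ge> real (card (gball E a r)) / 2"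
    by (simp add: b_def)
qed

lemma card_gball_ge:
  assumes a: "a \<in> {1..n}" and d: "d \<ge> 3" and sp: "sparse n \<eta> E" and \<eta>: "0 \<le> \<eta>" "\<eta> \<le> 1/8"
    and small: "4 * real (d - 1) ^ r \<le> real n powr (2/3)"
  shows "real (card (gball E a r)) \<ge> exp (- 4 * \<eta> * real r) * real (d - 1) ^ r"
  using small
proof (induction r)
  case (Suc r)
  have "4 * real (d - 1) ^ r \<le> 4 * real (d - 1) ^ Suc r"
    using d by (intro mult_left_mono power_increasing) auto
  with Suc have IH: "real (card (gball E a r)) \<ge> exp (- 4 * \<eta> * real r) * real (d - 1) ^ r" by linarith
  have "exp (- 4 * \<eta> * real (Suc r)) * real (d - 1) ^ Suc r
      = real (d - 1) * exp (- 4 * \<eta>) * (exp (- 4 * \<eta> * real r) * real (d - 1) ^ r)"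
    by (simp add: exp_add[symmetric] algebra_simps)
  also have "\<dots> \<le> real (d - 1) * exp (- 4 * \<eta>) * real (card (gball E a r))"
    by (intro mult_left_mono IH) auto
  also have "\<dots> \<le> real (card (gball E a (Suc r)))"
    by (rule gball_growth(1)[OF a d sp \<eta> Suc.prems])
  finally show ?case .
qed simp

text \<open>If a geodesic from \<open>a\<close> to \<open>b\<close> has \<open>v\<close> at position
  \<open>i\<close>, then \<open>a\<close> is within \<open>i\<close> and \<open>b\<close> within
  \<open>D - i\<close> of \<open>v\<close>. The two radii add up to \<open>D\<close>, so each
  \<open>i\<close> allows at most \<open>16 * (d - 1) ^ D\<close> pairs, each sending at most one
  unit.\<close>

lemma traffic_le:
  assumes d: "d \<ge> 3" and v: "v \<in> {1..n}"
    and diam: "\<And>a b. a \<in> {1..n} \<Longrightarrow> b \<in> {1..n} \<Longrightarrow> b \<in> gball E a D"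
  shows "traffic n E v \<le> 16 * real (Suc D) * real (d - 1) ^ D"
proof -
  define P where "P = {(a, b). a \<in> {1..n} \<and> b \<in> {1..n} \<and> a < b}"
  define Q where "Q = (\<Union>i\<in>{..D}. gball E v i \<times> gball E v (D - i))"
  define f where "f a b = real (card {p \<in> geodesics E a b. v \<in> set p}) / real (card (geodesics E a b))" for a b
  have finP: "finite P" by (rule finite_subset[of _ "{1..n} \<times> {1..n}"]) (auto simp: P_def)
  have finQ: "finite Q" unfolding Q_def using finite_gball by blast
  \<comment> \<open>When the set of geodesics is empty or infinite, \<open>card\<close> is 0 and the
    quotient is 0 by the convention on division.\<close>
  have f1: "f a b \<le> 1" for a b
  proof (cases "finite (geodesics E a b)")
    case True
    then have "card {p \<in> geodesics E a b. v \<in> set p} \<le> card (geodesics E a b)"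
      by (intro card_mono) auto
    then show ?thesis unfolding f_def by (auto simp: divide_le_eq_1)
  qed (simp add: f_def)
  have fQ: "f a b = 0" if "(a, b) \<in> P" "(a, b) \<notin> Q" for a b
  proof (rule ccontr)
    assume "f a b \<noteq> 0"
    then have "{p \<in> geodesics E a b. v \<in> set p} \<noteq> {}" unfolding f_def by force
    then obtain p where p: "p \<in> geodesics E a b" "v \<in> set p" by blast
    then have w: "is_walk E p" "hd p = a" "last p = b" by (auto simp: geodesics_def walks_def)
    obtain i where i: "i < length p" "p ! i = v" using p(2) by (auto simp: in_set_conv_nth)
    \<comment> \<open>\<open>length\<close> counts vertices, one more than the number of edges,
      hence \<open>Suc D\<close>.\<close>
    obtain p' where "p' \<in> walks E a b" "length p' \<le> Suc D"
      using gball_walk diam \<open>(a, b) \<in> P\<close> unfolding P_def by blast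
    then have len: "length p \<le> Suc D" using p(1) by (auto simp: geodesics_def)
    have "v \<in> gball E a i" using walk_in_gball[OF w(1) i(1)] w i by simp
    then have av: "a \<in> gball E v i" by (rule gball_sym)
    have "b \<in> gball E v (length p - 1 - i)"
      using walk_to_end_in_gball[OF w(1) i(1)] w i by simp
    moreover have "length p - 1 - i \<le> D - i" using len by linarith
    ultimately have "b \<in> gball E v (D - i)" using gball_mono by blast
    with av have "(a, b) \<in> Q" unfolding Q_def using i len by auto
    with that show False by simp
  qed
  have "traffic n E v = (\<Sum>(a, b)\<in>P. f a b)" by (simp add: traffic_def P_def f_def)
  also have "\<dots> = (\<Sum>(a, b)\<in>P \<inter> Q. f a b)"
    using finP fQ by (intro sum.mono_neutral_right) auto
  also have "\<dots> \<le> (\<Sum>(a, b)\<in>P \<inter> Q. 1)" using f1 by (intro sum_mono) auto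
  also have "\<dots> = real (card (P \<inter> Q))" by (simp add: case_prod_unfold)
  also have "card (P \<inter> Q) \<le> card Q" using finQ by (intro card_mono) auto
  also have "card Q \<le> (\<Sum>i\<in>{..D}. card (gball E v i \<times> gball E v (D - i)))"
    unfolding Q_def by (rule card_UN_le) simp
  also have "\<dots> \<le> (\<Sum>i\<in>{..D}. 16 * (d - 1) ^ D)"
  proof (rule sum_mono)
    fix i assume i: "i \<in> {..D}"
    have "card (gball E v i \<times> gball E v (D - i)) \<le> (4 * (d - 1) ^ i) * (4 * (d - 1) ^ (D - i))"
      unfolding card_cartesian_product by (intro mult_mono card_gball_le d) auto
    also have "\<dots> = 16 * ((d - 1) ^ i * (d - 1) ^ (D - i))" by simp
    also have "(d - 1) ^ i * (d - 1) ^ (D - i) = (d - 1) ^ D"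
      using i by (simp add: power_add[symmetric])
    finally show "card (gball E v i \<times> gball E v (D - i)) \<le> 16 * (d - 1) ^ D" .
  qed
  also have "\<dots> = Suc D * (16 * (d - 1) ^ D)" by simp
  finally show ?thesis by (simp add: algebra_simps)
qed

end

section \<open>Joining two balls\<close>

text \<open>The outer endpoint has to avoid both sets, so that switching two outgoing edges disturbs
  neither ball.\<close>

definition out :: "nat set set \<Rightarrow> nat set \<Rightarrow> nat set \<Rightarrow> (nat \<times> nat) set" where
  "out E A B = {(u, x). u \<in> A \<and> x \<notin> A \<and> x \<notin> B \<and> {u, x} \<in> E}"

definition cross :: "nat set set \<Rightarrow> nat set \<Rightarrow> nat set \<Rightarrow> (nat \<times> nat) set" where
  "cross E A B = {(u, w). u \<in> A \<and> w \<in> B \<and> {u, w} \<in> E}"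

text \<open>A switching of two outgoing edges adds one crossing edge and removes one outgoing edge on
  either side, which is why the bounds on the outgoing edges are weakened by \<open>j\<close>.\<close>
definition layered :: "nat \<Rightarrow> nat \<Rightarrow> nat \<Rightarrow> nat \<Rightarrow> nat \<Rightarrow> nat \<Rightarrow> nat \<Rightarrow> nat set set set" where
  "layered n d a b r s j = {E \<in> regular_graphs n d. gball E a r \<inter> gball E b r = {} \<and>
     card (cross E (gball E a r) (gball E b r)) = j \<and>
     s \<le> card (out E (gball E a r) (gball E b r)) + j \<and>
     s \<le> card (out E (gball E b r) (gball E a r)) + j}"

text \<open>The vertex \<open>u\<close> may lie in the ball, but as its neighbour \<open>x\<close>
  does not, \<open>u\<close> cannot be at distance less than \<open>r\<close>. Hence no vertex whose
  neighbours determine the ball is touched.\<close>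

lemma gball_switch:
  assumes "distinct [u, x, w, y]" "x \<notin> gball E a r" "w \<notin> gball E a r" "y \<notin> gball E a r" "{u, x} \<in> E"
  shows "gball (switch u x w y E) a r = gball E a r"
proof (rule gball_cong)
  fix v i assume i: "i < r" and v: "v \<in> gball E a i"
  have "gball E a (Suc i) \<subseteq> gball E a r" using i by (intro gball_mono) simp
  moreover have "gball E a i \<subseteq> gball E a r" using i by (intro gball_mono) simp
  ultimately have "v \<noteq> u" "v \<noteq> x" "v \<noteq> w" "v \<noteq> y"
    using v assms gball_step[of v E a i x] by blast+
  then show "nbrs (switch u x w y E) v = nbrs E v"
    by (simp add: nbrs_switch[OF assms(1)])
qed simp

lemma finite_out_cross:
  assumes "E \<in> regular_graphs n d"
  shows "finite (out E A B)" "finite (cross E A B)"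
  by (rule finite_subset[OF _ finite_arcs_regular[OF assms]]; auto simp: out_def cross_def arcs_def)+

text \<open>Both balls survive, so the counts before and after refer to the same vertex sets: the
  crossing edge \<open>(u, w)\<close> is gained, the outgoing edges \<open>(u, x)\<close> and
  \<open>(w, y)\<close> are lost, and \<open>{x, y}\<close> lies outside both balls.\<close>

lemma layered_switch:
  assumes E: "E \<in> layered n d a b r s j"
    and ux: "(u, x) \<in> out E (gball E a r) (gball E b r)"
    and wy: "(w, y) \<in> out E (gball E b r) (gball E a r)"
    and uw: "{u, w} \<notin> E" and xy: "{x, y} \<notin> E" "x \<noteq> y"
  shows "switch u x w y E \<in> layered n d a b r s (Suc j)"
    and "(u, w) \<in> cross (switch u x w y E) (gball (switch u x w y E) a r) (gball (switch u x w y E) b r)"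
    and "switchable u x w y E"
proof -
  define A where "A = gball E a r"
  define B where "B = gball E b r"
  define E' where "E' = switch u x w y E"
  have reg: "E \<in> regular_graphs n d" and AB: "A \<inter> B = {}" and j: "card (cross E A B) = j"
    and s: "s \<le> card (out E A B) + j" "s \<le> card (out E B A) + j"
    using E by (auto simp: layered_def A_def B_def)
  have mem: "u \<in> A" "x \<notin> A" "x \<notin> B" "{u, x} \<in> E" "w \<in> B" "y \<notin> A" "y \<notin> B" "{w, y} \<in> E"
    using ux wy by (auto simp: out_def A_def B_def)
  have mem': "u \<notin> B" "w \<notin> A" using mem AB by auto
  have sw: "switchable u x w y E"
    using mem mem' uw xy by (auto simp: switchable_def)
  then show "switchable u x w y E" .
  note dist = switchable_distinct[OF reg sw]
  have reg': "E' \<in> regular_graphs n d" unfolding E'_def by (rule switch_regular[OF reg sw])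
  have A': "gball E' a r = A" unfolding E'_def A_def
    by (rule gball_switch[OF dist]) (use mem mem' in \<open>auto simp: A_def\<close>)
  \<comment> \<open>Seen from \<open>w\<close>, it is the same switching with the two edges
    exchanged.\<close>
  have B': "gball E' b r = B" unfolding E'_def B_def switch_commute[of u x]
    by (rule gball_switch) (use mem mem' dist in \<open>auto simp: B_def\<close>)
  have "{p, q} \<in> E' \<longleftrightarrow> {p, q} \<in> E \<or> p = u \<and> q = w" if "p \<in> A" "q \<in> B" for p q
  proof -
    have "p \<noteq> x" "p \<noteq> w" "p \<noteq> y" "q \<noteq> u" "q \<noteq> x" "q \<noteq> y" using that mem mem' AB by auto
    then show ?thesis unfolding E'_def mem_switch by simp
  qed
  then have cross': "cross E' A B = insert (u, w) (cross E A B)"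
    using mem by (auto simp: cross_def)
  have "{p, q} \<in> E' \<longleftrightarrow> {p, q} \<in> E \<and> \<not> (p = u \<and> q = x)" if "p \<in> A" "q \<notin> A" "q \<notin> B" for p q
  proof -
    have "p \<noteq> x" "p \<noteq> w" "p \<noteq> y" "q \<noteq> u" "q \<noteq> w" using that mem mem' AB by auto
    then show ?thesis unfolding E'_def mem_switch by simp
  qed
  then have outA: "out E' A B = out E A B - {(u, x)}" by (auto simp: out_def)
  have "{p, q} \<in> E' \<longleftrightarrow> {p, q} \<in> E \<and> \<not> (p = w \<and> q = y)" if "p \<in> B" "q \<notin> A" "q \<notin> B" for p q
  proof -
    have "p \<noteq> x" "p \<noteq> u" "p \<noteq> y" "q \<noteq> u" "q \<noteq> w" using that mem mem' AB by auto
    then show ?thesis unfolding E'_def mem_switch by simp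
  qed
  then have outB: "out E' B A = out E B A - {(w, y)}" by (auto simp: out_def)
  note fin = finite_out_cross[OF reg]
  have "card (cross E' A B) = Suc j"
    using uw j fin by (simp add: cross' card_insert_if) (simp add: cross_def)
  moreover have "Suc (card (out E' A B)) = card (out E A B)"
    unfolding outA using ux fin by (intro card_Suc_Diff1) (auto simp: A_def B_def)
  moreover have "Suc (card (out E' B A)) = card (out E B A)"
    unfolding outB using wy fin by (intro card_Suc_Diff1) (auto simp: A_def B_def)
  ultimately have "E' \<in> layered n d a b r s (Suc j)"
    using reg' AB s by (simp add: layered_def A' B')
  then show "switch u x w y E \<in> layered n d a b r s (Suc j)" by (simp add: E'_def)
  have "(u, w) \<in> cross E' (gball E' a r) (gball E' b r)" unfolding A' B' cross' by simp
  then show "(u, w) \<in> cross (switch u x w y E) (gball (switch u x w y E) a r) (gball (switch u x w y E) b r)"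
    by (simp add: E'_def)
qed

text \<open>There are at least \<open>h\<close> choices for the outgoing edge of the first ball and
  then \<open>h - 3 * d * d\<close> for that of the second. To reverse, one picks one of the
  \<open>Suc j\<close> crossing edges as \<open>(u, w)\<close> and any of the \<open>n * d\<close>
  arcs as \<open>(x, y)\<close>.\<close>

lemma card_layered_step:
  assumes d: "d \<ge> 1" and h: "j + h \<le> s"
  shows "card (layered n d a b r s j) * (h * (h - 3 * d * d))
    \<le> card (layered n d a b r s (Suc j)) * (Suc j * (n * d))"
proof -
  define oA where "oA E = out E (gball E a r) (gball E b r)" for E
  define oB where "oB E = out E (gball E b r) (gball E a r)" for E
  define cr where "cr E = cross E (gball E a r) (gball E b r)" for E
  define ok where "ok E = (\<lambda>(u, x). {(w, y) \<in> oB E. y \<noteq> x \<and> {x, y} \<notin> E \<and> {u, w} \<notin> E})" for E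
  define X where "X E = Sigma (oA E) (ok E)" for E
  define Y where "Y E = (\<lambda>((u, w), (x, y)). ((u, x), (w, y))) ` (cr E \<times> arcs E)" for E
  define f where "f = (\<lambda>((u, x), (w, y)). switch u x w y)"
  define g where "g = (\<lambda>((u, x), (w, y)). switch u w x y)"
  show ?thesis
  proof (rule switching_count[where X = X and Y = Y and f = f and g = g])
    show "finite (layered n d a b r s j)" "finite (layered n d a b r s (Suc j))"
      unfolding layered_def by (simp_all add: finite_regular_graphs)
  next
    fix E assume "E \<in> layered n d a b r s j"
    then have reg: "E \<in> regular_graphs n d" and A: "h \<le> card (oA E)" and B: "h \<le> card (oB E)"
      using h by (auto simp: layered_def oA_def oB_def)
    note fin = finite_nbrs_regular[OF reg] and c = card_nbrs_regular_le[OF reg]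
    have finO: "finite (oA E)" "finite (oB E)"
      unfolding oA_def oB_def by (rule finite_out_cross[OF reg])+
    have finok: "finite (ok E p)" for p
      by (rule finite_subset[OF _ finO(2)]) (auto simp: ok_def)
    have each: "h - 3 * d * d \<le> card (ok E p)" for p
    proof -
      obtain u x where p: "p = (u, x)" by (cases p)
      \<comment> \<open>The excluded \<open>(w, y)\<close> have \<open>y = x\<close>, or
        \<open>y\<close> adjacent to \<open>x\<close>, or \<open>w\<close> adjacent to
        \<open>u\<close>; together at most \<open>d + 2 * d * d\<close>.\<close>
      define B1 where "B1 = prod.swap ` Sigma {x} (nbrs E)"
      define B2 where "B2 = prod.swap ` Sigma (nbrs E x) (nbrs E)"
      define B3 where "B3 = Sigma (nbrs E u) (nbrs E)"
      have fB: "finite B1" "finite B2" "finite B3" using fin by (auto simp: B1_def B2_def B3_def)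
      have "oB E \<subseteq> ok E p \<union> (B1 \<union> B2 \<union> B3)"
      proof
        fix z assume z: "z \<in> oB E"
        obtain w y where wy: "z = (w, y)" by (cases z)
        have e: "{w, y} \<in> E" "{y, w} \<in> E"
          using z by (auto simp: wy oB_def out_def insert_commute)
        show "z \<in> ok E p \<union> (B1 \<union> B2 \<union> B3)"
        proof (cases "y = x \<or> {x, y} \<in> E \<or> {u, w} \<in> E")
          case True
          with e show ?thesis by (auto simp: wy B1_def B2_def B3_def mem_nbrs image_iff)
        next
          case False
          with z show ?thesis by (simp add: ok_def p wy)
        qed
      qed
      then have "card (oB E) \<le> card (ok E p \<union> (B1 \<union> B2 \<union> B3))"
        by (rule card_mono[rotated]) (use finok fB in simp)
      also have "\<dots> \<le> card (ok E p) + card (B1 \<union> B2 \<union> B3)" by (rule card_Un_le)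
      also have "card (B1 \<union> B2 \<union> B3) \<le> card (B1 \<union> B2) + card B3" by (rule card_Un_le)
      also have "card (B1 \<union> B2) \<le> card B1 + card B2" by (rule card_Un_le)
      also have "card B1 \<le> card (Sigma {x} (nbrs E))" unfolding B1_def
        by (rule card_image_le) (use fin in auto)
      also have "\<dots> \<le> 1 * d" by (rule card_Sigma_nbrs_le[OF reg]) auto
      also have "card B2 \<le> card (Sigma (nbrs E x) (nbrs E))" unfolding B2_def
        by (rule card_image_le) (use fin in auto)
      also have "\<dots> \<le> d * d" by (rule card_Sigma_nbrs_le[OF reg fin c])
      also have "card B3 \<le> d * d" unfolding B3_def by (rule card_Sigma_nbrs_le[OF reg fin c])
      finally have "card (oB E) \<le> card (ok E p) + (1 * d + d * d + d * d)" by simp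
      moreover have "1 * d \<le> d * d" using d by (intro mult_right_mono) auto
      ultimately show ?thesis using B by linarith
    qed
    have "h * (h - 3 * d * d) \<le> card (oA E) * (h - 3 * d * d)" using A by (intro mult_right_mono) auto
    also have "\<dots> = (\<Sum>p\<in>oA E. h - 3 * d * d)" by simp
    also have "\<dots> \<le> (\<Sum>p\<in>oA E. card (ok E p))" by (intro sum_mono each)
    also have "\<dots> = card (X E)" unfolding X_def using finO finok by (subst card_SigmaI) auto
    finally show "finite (X E) \<and> h * (h - 3 * d * d) \<le> card (X E)"
      unfolding X_def using finO finok by blast
  next
    fix E assume "E \<in> layered n d a b r s (Suc j)"
    then have reg: "E \<in> regular_graphs n d" and cr: "card (cr E) = Suc j"
      by (auto simp: layered_def cr_def)
    have fin: "finite (cr E \<times> arcs E)"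
      unfolding cr_def using finite_out_cross[OF reg] finite_arcs_regular[OF reg] by blast
    have "card (Y E) \<le> card (cr E \<times> arcs E)" unfolding Y_def by (rule card_image_le[OF fin])
    also have "\<dots> = Suc j * (n * d)" by (simp only: card_cartesian_product cr card_arcs_regular[OF reg])
    finally show "finite (Y E) \<and> card (Y E) \<le> Suc j * (n * d)" using fin unfolding Y_def by blast
  next
    fix E t assume E: "E \<in> layered n d a b r s j" and t: "t \<in> X E"
    obtain u x w y where tt: "t = ((u, x), (w, y))" by (cases t) auto
    have mem: "(u, x) \<in> oA E" "(w, y) \<in> oB E" "x \<noteq> y" "{x, y} \<notin> E" "{u, w} \<notin> E"
      using t by (auto simp: tt X_def ok_def)
    define E' where "E' = switch u x w y E"
    note sw = layered_switch[OF E mem(1)[unfolded oA_def] mem(2)[unfolded oB_def] mem(5,4,3)]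
    have "(x, y) \<in> arcs E'" by (simp add: arcs_def E'_def switch_def)
    moreover have "(u, w) \<in> cr E'" using sw(2) by (simp add: cr_def E'_def)
    ultimately have "t \<in> Y E'" unfolding Y_def tt by force
    moreover have "switch u w x y E' = E" unfolding E'_def by (rule switch_switch[OF sw(3)])
    moreover have "E' \<in> layered n d a b r s (Suc j)" using sw(1) by (simp add: E'_def)
    ultimately show "f t E \<in> layered n d a b r s (Suc j) \<and> t \<in> Y (f t E) \<and> g t (f t E) = E"
      by (simp add: tt f_def g_def E'_def)
  qed
qed

text \<open>During the first \<open>J\<close> steps at least \<open>h\<close> outgoing edges remain
  on each side and \<open>Suc j \<le> J\<close>, so one ratio \<open>\<rho>\<close> serves for every
  step and the steps telescope.\<close>

lemma card_layered_0_le: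
  assumes d: "d \<ge> 1" and h: "J + h \<le> s" "3 * d * d < h"
    and \<rho>: "real J * real n * real d \<le> \<rho> * (real h * real (h - 3 * d * d))"
  shows "real (card (layered n d a b r s 0)) \<le> \<rho> ^ J * real (card (regular_graphs n d))"
proof -
  define H where "H = real h * real (h - 3 * d * d)"
  have "h > 0" "h - 3 * d * d > 0" using h by auto
  then have H0: "H > 0" unfolding H_def by (intro mult_pos_pos) (simp_all only: of_nat_0_less_iff)
  have "0 \<le> real J * real n * real d" by simp
  with \<rho> have "\<rho> * H \<ge> 0" unfolding H_def by linarith
  with H0 have \<rho>0: "\<rho> \<ge> 0" by (simp add: zero_le_mult_iff)
  have "real (card (layered n d a b r s 0)) \<le> \<rho> ^ j * real (card (layered n d a b r s j))" if "j \<le> J" for j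
    using that
  proof (induction j)
    case (Suc j)
    have "card (layered n d a b r s j) * (h * (h - 3 * d * d))
      \<le> card (layered n d a b r s (Suc j)) * (Suc j * (n * d))"
      using Suc.prems h by (intro card_layered_step d) simp
    then have "real (card (layered n d a b r s j) * (h * (h - 3 * d * d)))
      \<le> real (card (layered n d a b r s (Suc j)) * (Suc j * (n * d)))"
      by (simp only: of_nat_le_iff)
    then have "real (card (layered n d a b r s j)) * H
      \<le> real (card (layered n d a b r s (Suc j))) * (real (Suc j) * real n * real d)"
      unfolding H_def by (simp only: of_nat_mult mult.assoc)
    also have "\<dots> \<le> real (card (layered n d a b r s (Suc j))) * (real J * real n * real d)"
      using Suc.prems by (intro mult_left_mono mult_right_mono) auto
    also have "\<dots> \<le> real (card (layered n d a b r s (Suc j))) * (\<rho> * H)"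
      unfolding H_def by (intro mult_left_mono \<rho>) auto
    finally have "real (card (layered n d a b r s j)) \<le> \<rho> * real (card (layered n d a b r s (Suc j)))"
      using H0 by (simp add: mult_ac)
    then have "\<rho> ^ j * real (card (layered n d a b r s j))
        \<le> \<rho> ^ j * (\<rho> * real (card (layered n d a b r s (Suc j))))"
      using \<rho>0 by (intro mult_left_mono) auto
    with Suc show ?case by (simp add: mult_ac)
  qed simp
  from this[of J] have "real (card (layered n d a b r s 0)) \<le> \<rho> ^ J * real (card (layered n d a b r s J))"
    by simp
  also have "\<dots> \<le> \<rho> ^ J * real (card (regular_graphs n d))"
    using \<rho>0 by (intro mult_left_mono of_nat_mono card_mono finite_regular_graphs) (auto simp: layered_def)
  finally show ?thesis .
qed

text \<open>Every vertex of the next sphere is the outer end of an outgoing edge: were it in the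
  ball around \<open>b\<close>, the distance from \<open>a\<close> to \<open>b\<close> would be at
  most \<open>2 * r + 1\<close>.\<close>

lemma card_out_ge:
  assumes E: "E \<in> regular_graphs n d" and far: "b \<notin> gball E a (2 * r + 1)"
  shows "card (gball E a (Suc r) - gball E a r) \<le> card (out E (gball E a r) (gball E b r))"
proof -
  have "gball E a (Suc r) - gball E a r \<subseteq> snd ` out E (gball E a r) (gball E b r)"
  proof
    fix x assume x: "x \<in> gball E a (Suc r) - gball E a r"
    then obtain u where u: "u \<in> gball E a r" "{u, x} \<in> E" by (auto simp: mem_nbrs)
    have "x \<notin> gball E b r"
    proof
      assume "x \<in> gball E b r"
      then have "b \<in> gball E x r" by (rule gball_sym)
      then have "b \<in> gball E a (Suc r + r)" using x by (intro gball_trans) auto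
      with far show False by (simp add: mult_2)
    qed
    with x u have "(u, x) \<in> out E (gball E a r) (gball E b r)" by (simp add: out_def)
    then show "x \<in> snd ` out E (gball E a r) (gball E b r)" by force
  qed
  then show ?thesis by (rule surj_card_le[OF finite_out_cross(1)[OF E]])
qed

text \<open>A common vertex would give distance at most \<open>2 * r\<close>, a crossing edge at
  most \<open>2 * r + 1\<close>.\<close>

lemma far_imp_layered:
  assumes E: "E \<in> regular_graphs n d" and far: "b \<notin> gball E a (2 * r + 1)"
    and s: "s \<le> card (gball E a (Suc r) - gball E a r)" "s \<le> card (gball E b (Suc r) - gball E b r)"
  shows "E \<in> layered n d a b r s 0"
proof -
  have far': "a \<notin> gball E b (2 * r + 1)" using far gball_sym by blast
  have "gball E a r \<inter> gball E b r = {}"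
  proof (rule ccontr)
    assume "gball E a r \<inter> gball E b r \<noteq> {}"
    then obtain z where z: "z \<in> gball E a r" "b \<in> gball E z r" using gball_sym by blast
    have "b \<in> gball E a (r + r)" by (rule gball_trans[OF z(2,1)])
    then show False using far gball_mono[of "r + r" "2 * r + 1" E a] by auto
  qed
  moreover have "cross E (gball E a r) (gball E b r) = {}"
  proof (rule ccontr)
    assume "cross E (gball E a r) (gball E b r) \<noteq> {}"
    then obtain u w where uw: "u \<in> gball E a r" "w \<in> gball E b r" "{u, w} \<in> E"
      by (auto simp: cross_def)
    have "w \<in> gball E a (Suc r)" using uw by (intro gball_step) auto
    then have "b \<in> gball E a (Suc r + r)" using gball_sym[OF uw(2)] gball_trans by blast
    then show False using far by (simp add: mult_2)
  qed
  ultimately show ?thesis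
    using E s card_out_ge[OF E far] card_out_ge[OF E far'] by (simp add: layered_def)
qed

section \<open>Diameter and traffic\<close>

text \<open>The factor \<open>ln n\<close> on top of \<open>sqrt n\<close> makes the product of two
  sphere sizes of order \<open>n * (ln n)\<^sup>2\<close>, which beats the reverse count
  \<open>J * n * d\<close> with \<open>J\<close> of order \<open>ln n\<close>.\<close>

definition radius :: "nat \<Rightarrow> nat \<Rightarrow> nat" where
  "radius d n = nat \<lceil>log (real d - 1) (sqrt (real n) * ln (real n))\<rceil>"

lemma power_radius:
  assumes d: "d \<ge> 3" and n: "sqrt (real n) * ln (real n) \<ge> 1"
    "(real d - 1) * (sqrt (real n) * ln (real n)) \<le> real n"
  shows "sqrt (real n) * ln (real n) \<le> (real d - 1) ^ radius d n"
    and "(real d - 1) ^ radius d n \<le> (real d - 1) * (sqrt (real n) * ln (real n))"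
    and "real (radius d n) \<le> log (real d - 1) (real n)"
proof -
  define q where "q = real d - 1"
  define y where "y = sqrt (real n) * ln (real n)"
  define R where "R = radius d n"
  have q: "q \<ge> 2" using d by (simp add: q_def)
  have y: "y \<ge> 1" using n by (simp add: y_def)
  have "log q y \<ge> 0" using q y by simp
  then have R: "real R = of_int \<lceil>log q y\<rceil>" unfolding R_def radius_def q_def y_def by simp
  have lo: "log q y \<le> real R" and up: "real R \<le> log q y + 1" unfolding R by linarith+
  have "y = q powr (log q y)" using q y by simp
  also have "\<dots> \<le> q powr (real R)" using lo q by (intro powr_mono) auto
  also have "\<dots> = q ^ R" using q by (simp add: powr_realpow)
  finally show "sqrt (real n) * ln (real n) \<le> (real d - 1) ^ radius d n"
    by (simp add: y_def q_def R_def)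
  have "q ^ R = q powr (real R)" using q by (simp add: powr_realpow)
  also have "\<dots> \<le> q powr (log q y + 1)" using up q by (intro powr_mono) auto
  also have "\<dots> = q * y" using q y by (simp add: powr_add)
  finally have qR: "q ^ R \<le> q * y" .
  then show "(real d - 1) ^ radius d n \<le> (real d - 1) * (sqrt (real n) * ln (real n))"
    by (simp add: y_def q_def R_def)
  have "real R = log q (q ^ R)" using q by simp
  also have "\<dots> \<le> log q (real n)"
  proof (subst log_le_cancel_iff)
    show "q ^ R \<le> real n" using qR n(2) by (simp add: y_def q_def)
    then show "real n > 0" using q by (meson less_le_trans zero_less_power less_le_trans zero_less_numeral)
  qed (use q in auto)
  finally show "real (radius d n) \<le> log (real d - 1) (real n)"
    by (simp add: q_def R_def)
qed

text \<open>\<open>\<kappa>\<close> bounds the loss accumulated in the growth up to the chosen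
  radius. The spheres have at least \<open>2 * \<sigma>\<close> vertices, of which one
  \<open>\<sigma>\<close> pays for \<open>J\<close> and one for \<open>h\<close>. The conditions on
  \<open>n\<close> hold for all large \<open>n\<close>.\<close>

context
  fixes d n :: nat and A C q \<kappa> \<sigma> :: real
  defines "A \<equiv> exp 1 * real (d * d)"
  defines "C \<equiv> 8 * ln (2 * exp 1 * A)"
  defines "q \<equiv> real d - 1"
  defines "\<kappa> \<equiv> exp (- 4 * C / ln q)"
  defines "\<sigma> \<equiv> \<kappa> / 4 * (sqrt (real n) * ln (real n))"
  assumes d: "d \<ge> 3"
    and n: "2 * d + 2 * d * d \<le> n"
    and n_sparse: "8 * real n powr (2/3) \<le> real n" "A \<le> real n powr (1/12)" "C / ln (real n) \<le> 1/8"
    and n_radius: "1 \<le> sqrt (real n) * ln (real n)" "q * (sqrt (real n) * ln (real n)) \<le> real n"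
      "4 * q ^ 2 * (sqrt (real n) * ln (real n)) \<le> real n powr (2/3)"
    and n_switch: "3 * ln (real n) + 1 \<le> \<sigma>" "3 * real (d * d) + 1 \<le> \<sigma> / 2"
      "4 * ln (real n) * real n * real d \<le> exp (-1) * (\<sigma> / 2 * (\<sigma> / 2))"
    and n_log: "1 \<le> ln (real n)" "1 \<le> log q (real n)"
begin

private definition "\<eta> = C / ln (real n)"
text \<open>\<open>J\<close> switchings with ratio \<open>exp (-1)\<close> each reach
  \<open>n ^ (-3)\<close>, and \<open>h\<close> outgoing edges are kept in reserve
  throughout.\<close>

private definition "h = nat \<lfloor>\<sigma>\<rfloor>"
private definition "J = nat \<lceil>3 * ln (real n)\<rceil>"

private lemma q2: "q \<ge> 2" and q_eq: "real (d - 1) = q"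
  using d by (auto simp: q_def)

private lemma C0: "C \<ge> 0"
proof -
  have "real (d * d) \<ge> 1" using d by (cases d) auto
  then have "A \<ge> 1" unfolding A_def using mult_mono[of 1 "exp 1" 1 "real (d*d)"] by simp
  moreover have "2 * exp (1 :: real) \<ge> 1" using exp_ge_add_one_self[of 1] by linarith
  ultimately have "2 * exp 1 * A \<ge> 1" using mult_mono[of 1 "2 * exp 1" 1 A] by simp
  then show ?thesis by (simp add: C_def)
qed

private lemma \<eta>: "0 \<le> \<eta>" "\<eta> \<le> 1/8"
  using C0 n_log n_sparse by (auto simp: \<eta>_def)

text \<open>The radius is at most \<open>log q n\<close>, so \<open>\<eta>\<close> times the radius
  is at most the constant \<open>C / ln q\<close>. Hence the ball has at least
  \<open>4 * \<sigma>\<close> vertices and the next sphere at least half as many.\<close>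

private lemma sphere_ge:
  assumes E: "E \<in> regular_graphs n d" and sp: "sparse n \<eta> E" and a: "a \<in> {1..n}"
  shows "J + h \<le> card (gball E a (Suc (radius d n)) - gball E a (radius d n))"
proof -
  define R where "R = radius d n"
  note R = power_radius[OF d n_radius(1) n_radius(2)[unfolded q_def], folded q_def R_def]
  have "4 * q ^ Suc R = 4 * q * q ^ R" by simp
  also have "\<dots> \<le> 4 * q * (q * (sqrt (real n) * ln (real n)))"
    using q2 by (intro mult_left_mono R(2)) auto
  also have "\<dots> \<le> real n powr (2/3)" using n_radius(3) by (simp add: power2_eq_square mult_ac)
  finally have small: "4 * real (d - 1) ^ Suc R \<le> real n powr (2/3)" by (simp only: q_eq)
  have "q ^ R \<le> q ^ Suc R" using q2 by (intro power_increasing) auto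
  with small have small': "4 * real (d - 1) ^ R \<le> real n powr (2/3)" by (simp only: q_eq)
  have "\<eta> * real R \<le> \<eta> * log q (real n)" using R(3) \<eta> by (intro mult_left_mono) auto
  also have "\<dots> = C / ln q" using n_log by (simp add: \<eta>_def log_def)
  finally have "\<kappa> \<le> exp (- 4 * \<eta> * real R)" by (simp add: \<kappa>_def)
  then have "\<kappa> * (sqrt (real n) * ln (real n)) \<le> exp (- 4 * \<eta> * real R) * q ^ R"
    using R(1) n_radius(1) by (intro mult_mono) auto
  also have "\<dots> \<le> real (card (gball E a R))"
    using card_gball_ge[OF E a d sp \<eta> small'] by (simp only: q_eq)
  finally have "\<kappa> * (sqrt (real n) * ln (real n)) / 2 \<le> real (card (gball E a R)) / 2" by simp
  also have "\<dots> \<le> real (card (gball E a (Suc R) - gball E a R))"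
    by (rule gball_growth(2)[OF E a d sp \<eta> small])
  finally have "2 * \<sigma> \<le> real (card (gball E a (Suc R) - gball E a R))" by (simp add: \<sigma>_def)
  moreover have "real J \<le> 3 * ln (real n) + 1" unfolding J_def using n_log by linarith
  moreover have "real h \<le> \<sigma>" unfolding h_def using n_switch n_log by linarith
  ultimately have "real (J + h) \<le> real (card (gball E a (Suc R) - gball E a R))"
    using n_switch by simp
  then show ?thesis unfolding R_def by (simp only: of_nat_le_iff)
qed

text \<open>The cube leaves a factor \<open>1 / n\<close> after the union bound over the
  \<open>n * n\<close> pairs of centres.\<close>

private lemma card_layered_small:
  "real (card (layered n d a b r (J + h) 0)) \<le> 1 / real n ^ 3 * real (card (regular_graphs n d))"
proof -
  have h1: "real h \<ge> \<sigma> - 1" unfolding h_def by linarith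
  have "0 \<le> real (d * d)" by (rule of_nat_0_le_iff)
  with n_switch(2) have "3 * real (d * d) < \<sigma> - 1" "\<sigma> - 1 \<ge> \<sigma> / 2" by linarith+
  with h1 have "real (3 * d * d) < real h" by simp
  then have hd: "3 * d * d < h" by (simp only: of_nat_less_iff)
  have s2: "0 \<le> \<sigma> / 2" using n_switch(1) n_log by linarith
  have hs: "\<sigma> / 2 \<le> real h" using h1 \<open>\<sigma> - 1 \<ge> \<sigma> / 2\<close> by linarith
  have "real (h - 3 * d * d) = real h - 3 * real (d * d)" using hd by (simp add: of_nat_diff)
  then have hs': "\<sigma> / 2 \<le> real (h - 3 * d * d)" using h1 n_switch(2) by linarith
  have J: "real J \<le> 4 * ln (real n)" "real J \<ge> 3 * ln (real n)" unfolding J_def using n_log by linarith+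
  have "real J * real n * real d \<le> 4 * ln (real n) * real n * real d"
    by (intro mult_right_mono J) auto
  also have "\<dots> \<le> exp (-1) * (\<sigma> / 2 * (\<sigma> / 2))" by (rule n_switch(3))
  also have "\<dots> \<le> exp (-1) * (real h * real (h - 3 * d * d))"
    by (intro mult_left_mono mult_mono hs hs' s2) auto
  finally have "real (card (layered n d a b r (J + h) 0)) \<le> exp (-1) ^ J * real (card (regular_graphs n d))"
    using d hd by (intro card_layered_0_le[of d J h]) auto
  also have "exp (-1) ^ J \<le> 1 / real n ^ 3"
  proof -
    have n0: "real n > 0" using n d by (cases n) auto
    have "exp (-1) ^ J = exp (- real J)" by (simp add: exp_of_nat_mult[symmetric])
    also have "\<dots> \<le> exp (- (real 3 * ln (real n)))" using J by simp
    also have "\<dots> = 1 / exp (real 3 * ln (real n))" by (simp only: exp_minus inverse_eq_divide)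
    also have "\<dots> = 1 / real n ^ 3" using n0 by (simp only: exp_of_nat_mult exp_ln)
    finally show ?thesis .
  qed
  finally show ?thesis by (simp add: mult_right_mono)
qed

private lemma max_traffic_good:
  assumes E: "E \<in> regular_graphs n d" and sp: "sparse n \<eta> E"
    and good: "\<And>a b. a \<in> {1..n} \<Longrightarrow> b \<in> {1..n} \<Longrightarrow> E \<notin> layered n d a b (radius d n) (J + h) 0"
  shows "max_traffic n E \<le> 64 * q ^ 3 * (ln q) ^ 2 * real n * (log q (real n)) ^ 3"
proof -
  define R where "R = radius d n"
  note R = power_radius[OF d n_radius(1) n_radius(2)[unfolded q_def], folded q_def R_def]
  define D where "D = 2 * R + 1"
  have n0: "real n > 0" "n \<ge> 1" using n d by (cases n; auto)+
  have diam: "b \<in> gball E a D" if ab: "a \<in> {1..n}" "b \<in> {1..n}" for a b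
  proof (rule ccontr)
    assume "b \<notin> gball E a D"
    then have "E \<in> layered n d a b R (J + h) 0" unfolding D_def
      using sphere_ge[OF E sp ab(1)] sphere_ge[OF E sp ab(2)]
      by (intro far_imp_layered E) (simp_all add: R_def)
    with good[OF ab] show False by (simp add: R_def)
  qed
  have lnq: "ln (real n) = log q (real n) * ln q" using q2 by (simp add: log_def)
  have "traffic n E v \<le> 64 * q ^ 3 * (ln q) ^ 2 * real n * (log q (real n)) ^ 3" if v: "v \<in> {1..n}" for v
  proof -
    have "traffic n E v \<le> 16 * real (Suc D) * q ^ D"
      using traffic_le[OF E d v diam] by (simp only: q_eq)
    also have "q ^ D = q * (q ^ R) ^ 2" by (simp add: D_def power_mult[symmetric] mult.commute)
    \<comment> \<open>Two of the three logarithms come from \<open>(q ^ R) ^ 2\<close>, the third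
      from \<open>Suc D = 2 * R + 2\<close>, which is at most \<open>4 * log q n\<close>.\<close>
    also have "16 * real (Suc D) * (q * (q ^ R) ^ 2)
      \<le> 16 * (4 * log q (real n)) * (q * (q * (sqrt (real n) * ln (real n))) ^ 2)"
    proof (intro mult_mono mult_left_mono power_mono R(2))
      show "real (Suc D) \<le> 4 * log q (real n)" using R(3) n_log(2) by (simp add: D_def)
    qed (use q2 n_log n0 in auto)
    also have "\<dots> = 64 * q ^ 3 * ((sqrt (real n)) ^ 2 * ln (real n) ^ 2) * log q (real n)"
      by (simp add: power_mult_distrib power2_eq_square power3_eq_cube mult_ac)
    also have "(sqrt (real n)) ^ 2 * ln (real n) ^ 2 = real n * (log q (real n) ^ 2 * (ln q) ^ 2)"
      using n0 by (simp add: lnq power_mult_distrib)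
    also have "64 * q ^ 3 * \<dots> * log q (real n) = 64 * q ^ 3 * (ln q) ^ 2 * real n * (log q (real n)) ^ 3"
      by (simp add: power2_eq_square power3_eq_cube mult_ac)
    finally show ?thesis .
  qed
  then show ?thesis unfolding max_traffic_def using n0 by (subst Max_le_iff) auto
qed

text \<open>A graph violating the bound is either not sparse or in the lowest layer for some pair of
  centres; the two error terms are the densities of these events.\<close>

lemma prob_max_traffic_ge:
  assumes "even (n * d)"
  shows "measure_pmf.prob (pmf_of_set (regular_graphs n d))
      {E. max_traffic n E \<le> 64 * q ^ 3 * (ln q) ^ 2 * real n * (log q (real n)) ^ 3}
    \<ge> 1 - (real n powr (-1/8) + 1 / real n)"
proof -
  let ?S = "regular_graphs n d"
  let ?X = "{E. max_traffic n E \<le> 64 * q ^ 3 * (ln q) ^ 2 * real n * (log q (real n)) ^ 3}"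
  let ?L = "\<lambda>(a, b). layered n d a b (radius d n) (J + h) 0"
  let ?V = "{1..n} \<times> {1..n}"
  have n0: "real n > 0" using n d by (cases n) auto
  have ne: "?S \<noteq> {}" using n d assms by (intro regular_graphs_nonempty) auto
  then have S0: "real (card ?S) > 0" using finite_regular_graphs by (simp add: card_gt_0_iff)
  have finL: "finite (\<Union>p\<in>?V. ?L p)"
    by (auto simp: layered_def finite_regular_graphs)
  have "?S - ?X \<subseteq> {E \<in> ?S. \<not> sparse n \<eta> E} \<union> (\<Union>p\<in>?V. ?L p)"
    using max_traffic_good by fastforce
  then have "card (?S - ?X) \<le> card ({E \<in> ?S. \<not> sparse n \<eta> E} \<union> (\<Union>p\<in>?V. ?L p))"
    by (rule card_mono[rotated]) (use finL finite_regular_graphs in auto)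
  also have "\<dots> \<le> card {E \<in> ?S. \<not> sparse n \<eta> E} + card (\<Union>p\<in>?V. ?L p)"
    by (rule card_Un_le)
  also have "card (\<Union>p\<in>?V. ?L p) \<le> (\<Sum>p\<in>?V. card (?L p))" by (rule card_UN_le) simp
  finally have "real (card (?S - ?X)) \<le> real (card {E \<in> ?S. \<not> sparse n \<eta> E}) + (\<Sum>p\<in>?V. real (card (?L p)))"
    by (simp only: of_nat_sum[symmetric] of_nat_add[symmetric] of_nat_le_iff)
  also have "real (card {E \<in> ?S. \<not> sparse n \<eta> E}) \<le> real n powr (-1/8) * real (card ?S)"
    unfolding \<eta>_def C_def A_def
    by (rule card_not_sparse_le[OF d n n_sparse(1)])
       (use n_sparse in \<open>auto simp: A_def C_def\<close>)
  also have "(\<Sum>p\<in>?V. real (card (?L p))) \<le> (\<Sum>p\<in>?V. 1 / real n ^ 3 * real (card ?S))"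
    using card_layered_small by (intro sum_mono) (auto split: prod.split)
  also have "\<dots> = 1 / real n * real (card ?S)"
    using n0 by (simp add: card_cartesian_product power3_eq_cube)
  finally have bad: "real (card (?S - ?X)) \<le> (real n powr (-1/8) + 1 / real n) * real (card ?S)"
    by (simp add: algebra_simps)
  have "card ?S = card (?S - ?X) + card (?S \<inter> ?X)"
    using finite_regular_graphs by (metis card_Diff_subset_Int Int_Diff_Un card_Int_Diff add.commute)
  then have "real (card ?S) = real (card (?S - ?X)) + real (card (?S \<inter> ?X))" by simp
  with bad have "(1 - (real n powr (-1/8) + 1 / real n)) * real (card ?S) \<le> real (card (?S \<inter> ?X))"
    by (simp add: algebra_simps)
  then show ?thesis
    using ne S0 finite_regular_graphs by (simp add: measure_pmf_of_set pos_le_divide_eq)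
qed

end

theorem mainTheorem2:
  fixes d :: nat
  assumes "d \<ge> 3"
  shows "\<exists>K::real. \<forall>\<epsilon>>0. \<exists>N. \<forall>n\<ge>N. even (n * d) \<longrightarrow>
           measure_pmf.prob (pmf_of_set (regular_graphs n d))
             {E. max_traffic n E \<le> K * real n * (log (real d - 1) (real n)) ^ 3} \<ge> 1 - \<epsilon>"
proof -
  define A where "A = exp 1 * real (d * d)"
  define C where "C = 8 * ln (2 * exp 1 * A)"
  define q where "q = real d - 1"
  define \<kappa> where "\<kappa> = exp (- 4 * C / ln q)"
  define K where "K = 64 * q ^ 3 * (ln q) ^ 2"
  have pos: "q > 1" "\<kappa> > 0" "A > 0" "real d > 0" using assms by (auto simp: q_def \<kappa>_def A_def)
  show ?thesis
  proof (intro exI[of _ K] allI impI)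
    fix \<epsilon> :: real assume \<epsilon>: "\<epsilon> > 0"
    have "((\<lambda>n. real n powr (-1/8) + 1 / real n) \<longlongrightarrow> 0) sequentially" by real_asymp
    then have "\<forall>\<^sub>F n in sequentially. real n powr (-1/8) + 1 / real n < \<epsilon>"
      using \<epsilon> by (rule order_tendstoD(2))
    moreover have "\<forall>\<^sub>F n in sequentially. 2 * d + 2 * d * d \<le> n" by (rule eventually_ge_at_top)
    moreover have "\<forall>\<^sub>F n in sequentially. 8 * real n powr (2/3) \<le> real n" by real_asymp
    moreover have "\<forall>\<^sub>F n in sequentially. A \<le> real n powr (1/12)" using pos by real_asymp
    moreover have "\<forall>\<^sub>F n in sequentially. C / ln (real n) \<le> 1/8" by real_asymp
    moreover have "\<forall>\<^sub>F n in sequentially. 1 \<le> sqrt (real n) * ln (real n)" by real_asymp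
    moreover have "\<forall>\<^sub>F n in sequentially. q * (sqrt (real n) * ln (real n)) \<le> real n"
      using pos by real_asymp
    moreover have "\<forall>\<^sub>F n in sequentially. 4 * q ^ 2 * (sqrt (real n) * ln (real n)) \<le> real n powr (2/3)"
      using pos by real_asymp
    moreover have "\<forall>\<^sub>F n in sequentially. 3 * ln (real n) + 1 \<le> \<kappa> / 4 * (sqrt (real n) * ln (real n))"
      using pos by real_asymp
    moreover have "\<forall>\<^sub>F n in sequentially. 3 * real (d * d) + 1 \<le> \<kappa> / 4 * (sqrt (real n) * ln (real n)) / 2"
      using pos by real_asymp
    \<comment> \<open>Here \<open>n * ln n\<close> is compared with
      \<open>n * (ln n)\<^sup>2\<close>: the logarithm in the radius is what makes this
      hold.\<close>
    moreover have "\<forall>\<^sub>F n in sequentially. 4 * ln (real n) * real n * real d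
        \<le> exp (-1) * (\<kappa> / 4 * (sqrt (real n) * ln (real n)) / 2 * (\<kappa> / 4 * (sqrt (real n) * ln (real n)) / 2))"
      using pos by real_asymp
    moreover have "\<forall>\<^sub>F n in sequentially. 1 \<le> ln (real n)" by real_asymp
    moreover have "\<forall>\<^sub>F n in sequentially. 1 \<le> log q (real n)" using pos by real_asymp
    ultimately have "\<forall>\<^sub>F n in sequentially. even (n * d) \<longrightarrow>
           measure_pmf.prob (pmf_of_set (regular_graphs n d))
             {E. max_traffic n E \<le> K * real n * (log (real d - 1) (real n)) ^ 3} \<ge> 1 - \<epsilon>"
    proof eventually_elim
      case (elim n)
      show ?case
      proof
        assume even: "even (n * d)"
        show "measure_pmf.prob (pmf_of_set (regular_graphs n d))
             {E. max_traffic n E \<le> K * real n * (log (real d - 1) (real n)) ^ 3} \<ge> 1 - \<epsilon>"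
          using prob_max_traffic_ge[OF assms elim(2,3) elim(4)[unfolded A_def]
              elim(5)[unfolded A_def C_def] elim(6) elim(7,8)[unfolded q_def]
              elim(9-11)[unfolded A_def C_def q_def \<kappa>_def] elim(12) elim(13)[unfolded q_def] even] elim(1)
          unfolding K_def q_def by linarith
      qed
    qed
    then show "\<exists>N. \<forall>n\<ge>N. even (n * d) \<longrightarrow>
           measure_pmf.prob (pmf_of_set (regular_graphs n d))
             {E. max_traffic n E \<le> K * real n * (log (real d - 1) (real n)) ^ 3} \<ge> 1 - \<epsilon>"
      by (simp only: eventually_sequentially)
  qed
qed

end
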